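(* For $j=1,2$, let $F_j\in C^2(\mathbb{R})$ be non-increasing with $F_j(0)=0$, and assume that $F_j$ is (real) analytic on $\mathbb{R}$. For $\delta\in[0,1]$ let $u_{j,\delta}\in C^{2+\alpha}(\overline{\Omega})$ be the solution of $$-|a|^{\frac12}\sum_{i,k=1}^n \partial_{x_i}\left(|a|^{-\frac12}a_{i,k}\,\partial_{x_k}u_{j,\delta}\right)=F_j(u_{j,\delta})\ \text{in }\Omega,\qquad u_{j,\delta}=\delta g\ \text{on }\partial\Omega.$$ Then, for any $x_0\in\partial\Omega$ and any $\delta_0\in(0,1]$, the condition $$\partial_{\nu_a}u_{1,\delta}(x_0)=\partial_{\nu_a}u_{2,\delta}(x_0)\quad\text{for all }\delta\in[0,\delta_0]$$ implies that $F_1=F_2$.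
   Context: Let $n\ge2$, $\alpha\in(0,1)$, and let $\Omega\subset\mathbb{R}^n$ be a bounded connected domain with $C^{2+\alpha}$ boundary. Let $a=(a_{i,j})_{1\le i,j\le n}\in C^2(\overline{\Omega};\mathbb{R}^{n^2})$ be symmetric ($a_{i,j}=a_{j,i}$) and elliptic: there is $c>0$ with $\sum_{i,j}a_{i,j}(x)\xi_i\xi_j\ge c|\xi|^2$ for all $x\in\overline\Omega$, $\xi\in\mathbb{R}^n$. $|a|$ denotes the absolute value of the determinant of $a$. Let $g\in C^{2+\alpha}(\partial\Omega)$ satisfy $g(\partial\Omega)=[0,R]$ with $R>0$. For non-increasing $F\in C^1(\mathbb{R})$ with $F(0)=0$, the boundary value problem with source $F(u)$ and Dirichlet data $\delta g$ has a unique solution in $C^{2+\alpha}(\overline\Omega)$ for every $\delta\in[0,1]$. With $\nu$ the outward unit normal to $\partial\Omega$, $\partial_{\nu_a}v(x)=\sum_{i,j=1}^n a_{i,j}(x)\,\partial_{x_j}v(x)\,\nu_i(x)$ for $x\in\partial\Omega$. *)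

theory Defs
  imports "HOL-Analysis.Analysis"
begin

section \<open>Derivatives and Hoelder spaces\<close>

definition pd :: "'a::euclidean_space \<Rightarrow> ('a \<Rightarrow> 'b::real_normed_vector) \<Rightarrow> 'a \<Rightarrow> 'b" where
  "pd b f x = frechet_derivative f (at x) b"

text \<open>\<open>foldr pd bs f\<close> is the iterated partial derivative of \<open>f\<close> along the list \<open>bs\<close> of basis vectors.
  The following definitions are meant for open sets \<open>S\<close> and \<open>\<Omega>\<close>.\<close>

definition Ck_on :: "nat \<Rightarrow> 'a::euclidean_space set \<Rightarrow> ('a \<Rightarrow> 'b::real_normed_vector) \<Rightarrow> bool" where
  "Ck_on k S f \<longleftrightarrow>
     (\<forall>bs. set bs \<subseteq> Basis \<and> length bs < k \<longrightarrow> foldr pd bs f differentiable_on S) \<and>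
     (\<forall>bs. set bs \<subseteq> Basis \<and> length bs \<le> k \<longrightarrow> continuous_on S (foldr pd bs f))"

text \<open>Membership in $C^k(\overline\Omega)$: all derivatives up to order \<open>k\<close>, taken in \<open>\<Omega>\<close>, extend
  continuously to the closure. On the boundary itself only the values of \<open>f\<close> are constrained.\<close>

definition Ck_closure :: "nat \<Rightarrow> 'a::euclidean_space set \<Rightarrow> ('a \<Rightarrow> 'b::real_normed_vector) \<Rightarrow> bool" where
  "Ck_closure k \<Omega> f \<longleftrightarrow>
     Ck_on k \<Omega> f \<and> continuous_on (closure \<Omega>) f \<and>
     (\<forall>bs. set bs \<subseteq> Basis \<and> length bs \<le> k \<longrightarrow>
        (\<exists>h. continuous_on (closure \<Omega>) h \<and> (\<forall>x\<in>\<Omega>. h x = foldr pd bs f x)))"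

definition Ck_holder_on ::
    "nat \<Rightarrow> real \<Rightarrow> 'a::euclidean_space set \<Rightarrow> ('a \<Rightarrow> 'b::real_normed_vector) \<Rightarrow> bool" where
  "Ck_holder_on k \<alpha> S f \<longleftrightarrow>
     Ck_on k S f \<and>
     (\<forall>bs. set bs \<subseteq> Basis \<and> length bs = k \<longrightarrow>
        (\<exists>C. \<forall>x\<in>S. \<forall>y\<in>S. norm (foldr pd bs f x - foldr pd bs f y) \<le> C * dist x y powr \<alpha>))"

definition Ck_holder_closure ::
    "nat \<Rightarrow> real \<Rightarrow> 'a::euclidean_space set \<Rightarrow> ('a \<Rightarrow> 'b::real_normed_vector) \<Rightarrow> bool" where
  "Ck_holder_closure k \<alpha> \<Omega> f \<longleftrightarrow> Ck_closure k \<Omega> f \<and> Ck_holder_on k \<alpha> \<Omega> f"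

definition real_analytic_on :: "real set \<Rightarrow> (real \<Rightarrow> real) \<Rightarrow> bool" where
  "real_analytic_on S f \<longleftrightarrow>
     (\<forall>x\<in>S. \<exists>r>0. \<exists>c. \<forall>y. \<bar>y - x\<bar> < r \<longrightarrow> (\<lambda>m. c m * (y - x) ^ m) sums f y)"

section \<open>Regular boundaries\<close>

text \<open>A chart straightening the boundary near \<open>x\<close>: \<open>\<psi>\<close> maps \<open>U\<close> diffeomorphically onto \<open>\<psi> ` U\<close>, with
  inverse \<open>\<phi>\<close>, and the basis vector \<open>b\<close> singles out the coordinate that defines the half-space.\<close>

definition boundary_chart ::
    "nat \<Rightarrow> real \<Rightarrow> 'a::euclidean_space set \<Rightarrow> 'a \<Rightarrow> 'a set \<Rightarrow> ('a \<Rightarrow> 'a) \<Rightarrow> ('a \<Rightarrow> 'a) \<Rightarrow> 'a \<Rightarrow> bool" where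
  "boundary_chart k \<alpha> \<Omega> x U \<psi> \<phi> b \<longleftrightarrow>
     open U \<and> x \<in> U \<and> open (\<psi> ` U) \<and> (\<forall>y\<in>U. \<phi> (\<psi> y) = y) \<and>
     Ck_holder_on k \<alpha> U \<psi> \<and> Ck_holder_on k \<alpha> (\<psi> ` U) \<phi> \<and> b \<in> Basis \<and>
     \<psi> ` (U \<inter> \<Omega>) = {z \<in> \<psi> ` U. z \<bullet> b > 0} \<and>
     \<psi> ` (U \<inter> frontier \<Omega>) = {z \<in> \<psi> ` U. z \<bullet> b = 0}"

definition Ck_holder_boundary :: "nat \<Rightarrow> real \<Rightarrow> 'a::euclidean_space set \<Rightarrow> bool" where
  "Ck_holder_boundary k \<alpha> \<Omega> \<longleftrightarrow> (\<forall>x\<in>frontier \<Omega>. \<exists>U \<psi> \<phi> b. boundary_chart k \<alpha> \<Omega> x U \<psi> \<phi> b)"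

text \<open>Membership in $C^{k+\alpha}(\partial\Omega)$, by composition with charts. The chart expression of \<open>g\<close> lives
  on a relatively open subset of the hyperplane orthogonal to \<open>b\<close>; it is regarded as a function on
  the cylinder over that subset which does not depend on the \<open>b\<close>-coordinate.\<close>

definition Ck_holder_frontier ::
    "nat \<Rightarrow> real \<Rightarrow> 'a::euclidean_space set \<Rightarrow> ('a \<Rightarrow> real) \<Rightarrow> bool" where
  "Ck_holder_frontier k \<alpha> \<Omega> g \<longleftrightarrow>
     (\<forall>x\<in>frontier \<Omega>. \<exists>U \<psi> \<phi> b. boundary_chart k \<alpha> \<Omega> x U \<psi> \<phi> b \<and>
        Ck_holder_on k \<alpha> {z. z - (z \<bullet> b) *\<^sub>R b \<in> \<psi> ` U} (\<lambda>z. g (\<phi> (z - (z \<bullet> b) *\<^sub>R b))))"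

text \<open>The outward unit normal is orthogonal to the velocity of every curve in the boundary that
  passes through \<open>x\<close>, and points out of \<open>\<Omega>\<close>.\<close>

definition is_outward_unit_normal :: "'a::euclidean_space set \<Rightarrow> 'a \<Rightarrow> 'a \<Rightarrow> bool" where
  "is_outward_unit_normal \<Omega> x \<nu> \<longleftrightarrow>
     norm \<nu> = 1 \<and>
     (\<forall>\<gamma> v. \<gamma> 0 = x \<and> (\<forall>\<^sub>F t in nhds 0. \<gamma> t \<in> frontier \<Omega>) \<and> (\<gamma> has_vector_derivative v) (at 0)
        \<longrightarrow> \<nu> \<bullet> v = 0) \<and>
     (\<forall>\<^sub>F t in at_right 0. x + t *\<^sub>R \<nu> \<notin> closure \<Omega>)"

definition outward_unit_normal :: "'a::euclidean_space set \<Rightarrow> 'a \<Rightarrow> 'a" where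
  "outward_unit_normal \<Omega> x = (THE \<nu>. is_outward_unit_normal \<Omega> x \<nu>)"

section \<open>The boundary value problem\<close>

definition elliptic_op ::
    "(real^'n \<Rightarrow> real^'n^'n) \<Rightarrow> (real^'n \<Rightarrow> real) \<Rightarrow> real^'n \<Rightarrow> real" where
  "elliptic_op a u x =
     - (\<bar>det (a x)\<bar> powr (1/2) *
        (\<Sum>i\<in>UNIV. \<Sum>k\<in>UNIV.
           pd (axis i 1) (\<lambda>y. \<bar>det (a y)\<bar> powr (-1/2) * a y $ i $ k * pd (axis k 1) u y) x))"

definition dirichlet_solution ::
    "real \<Rightarrow> (real^'n) set \<Rightarrow> (real^'n \<Rightarrow> real^'n^'n) \<Rightarrow> (real \<Rightarrow> real) \<Rightarrow> (real^'n \<Rightarrow> real) \<Rightarrow>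
     (real^'n \<Rightarrow> real) \<Rightarrow> bool" where
  "dirichlet_solution \<alpha> \<Omega> a F h u \<longleftrightarrow>
     Ck_holder_closure 2 \<alpha> \<Omega> u \<and>
     (\<forall>x\<in>\<Omega>. elliptic_op a u x = F (u x)) \<and>
     (\<forall>x\<in>frontier \<Omega>. u x = h x)"

text \<open>At boundary points a first derivative of \<open>v\<close> means its continuous extension from \<open>\<Omega>\<close>.\<close>

definition conormal_derivative ::
    "(real^'n) set \<Rightarrow> (real^'n \<Rightarrow> real^'n^'n) \<Rightarrow> (real^'n \<Rightarrow> real) \<Rightarrow> real^'n \<Rightarrow> real" where
  "conormal_derivative \<Omega> a v x =
     (\<Sum>i\<in>UNIV. \<Sum>j\<in>UNIV.
        a x $ i $ j * Lim (at x within \<Omega>) (pd (axis j 1) v) * outward_unit_normal \<Omega> x $ i)"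

end

theory Submission
  imports Defs "HOL-Complex_Analysis.Cauchy_Integral_Formula"
begin

text \<open>Suppose that \<open>F\<^sub>1 \<noteq> F\<^sub>2\<close>. The difference \<open>F\<^sub>1 - F\<^sub>2\<close> is analytic, vanishes at 0 and is not
  identically zero, so it has a strict sign on some interval \<open>{0<..e}\<close> (\<open>real_analytic_right_sign\<close>);
  by symmetry let \<open>F\<^sub>2 < F\<^sub>1\<close> there. Choose \<open>\<delta> > 0\<close> so small that the boundary values \<open>\<delta> g\<close> lie in
  \<open>{0..e}\<close>. Since the sources are non-increasing and vanish at 0, the minimum principle confines
  \<open>u\<^sub>1\<close> to \<open>{0..e}\<close>. With \<open>L\<close> denoting the negative of the elliptic operator, the difference
  \<open>w = u\<^sub>1 - u\<^sub>2\<close> then satisfies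
  \<open>L w = F\<^sub>2(u\<^sub>2) - F\<^sub>1(u\<^sub>1) \<le> F\<^sub>2(u\<^sub>2) - F\<^sub>2(u\<^sub>1)\<close> and \<open>w = 0\<close> on the boundary. The right-hand
  side is at most 0 where \<open>w < 0\<close> and at most \<open>Q w\<close> where \<open>w \<ge> 0\<close>, for a Lipschitz constant
  \<open>Q\<close> of \<open>F\<^sub>2\<close>. Hence \<open>w \<ge> 0\<close>, and either \<open>w = 0\<close> or \<open>w > 0\<close> in all of \<open>\<Omega>\<close>. The first
  case would give \<open>F\<^sub>1(u\<^sub>1) = F\<^sub>2(u\<^sub>1)\<close>, that is \<open>u\<^sub>1 = 0\<close>, although \<open>\<delta> g\<close> is positive somewhere.
  In the second case the Hopf boundary lemma shows that \<open>w\<close> grows at a positive rate along every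
  direction pointing from \<open>x\<^sub>0\<close> into \<open>\<Omega>\<close>. The vector \<open>- a \<nu>\<close> is such a direction because
  \<open>\<nu> \<bullet> a \<nu> \<ge> c\<close>, so the conormal derivative of \<open>w\<close> at \<open>x\<^sub>0\<close> is negative
  (\<open>conormal_derivative_strict_comparison\<close>), contrary to the assumed equality.

  The minimum principles and the Hopf lemma all rest on one comparison argument
  (\<open>hopf_barrier_bound\<close>) near a point of a hypersurface \<open>{\<rho> = 0}\<close>, where \<open>\<rho>\<close> is twice differentiable
  with non-zero gradient. The barrier is \<open>\<rho> + K \<rho>\<^sup>2 - |x - x\<^sub>0|\<^sup>2\<close>: the square of \<open>\<rho>\<close> contributes
  \<open>2 K (\<nabla>\<rho> \<bullet> A \<nabla>\<rho>)\<close> to its image under \<open>L\<close>, which beats all other terms when \<open>K\<close> is large, and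
  the subtracted term makes the barrier non-positive on the hypersurface and negative there away
  from \<open>x\<^sub>0\<close>. Taking \<open>\<rho>\<close> from a
  boundary chart gives the Hopf lemma on \<open>\<Omega>\<close>, without constructing an interior ball; taking
  \<open>\<rho> = R\<^sup>2 - |x - z|\<^sup>2\<close> gives the strong minimum principle, and that one yields the weak
  minimum principle.\<close>

section \<open>Second-order conditions at a minimum\<close>

text \<open>The trace of the product of two positive semidefinite forms is non-negative. The proof is a Cholesky
  elimination on the set \<open>S\<close> of rows that may be non-zero. If the pivot \<open>A$k$k\<close> vanishes,
  semidefiniteness forces the whole row to vanish. Otherwise subtracting the rank-one matrix with
  entries \<open>A$k$i * A$k$j / A$k$k\<close> clears row \<open>k\<close> and keeps \<open>A\<close> semidefinite, and that matrix
  contributes \<open>(A$k \<bullet> H (A$k)) / A$k$k\<close> to the trace.\<close>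

lemma trace_form_nonneg_aux:
  fixes A :: "real^'n^'n" and H :: "real^'n \<Rightarrow> real^'n"
  assumes "finite S" "linear H" "\<And>v. 0 \<le> v \<bullet> H v"
  shows "(\<And>i j. A$i$j = A$j$i) \<Longrightarrow> (\<And>v. 0 \<le> v \<bullet> (A *v v)) \<Longrightarrow>
         (\<And>i j. i \<notin> S \<Longrightarrow> A$i$j = 0) \<Longrightarrow> 0 \<le> (\<Sum>i\<in>UNIV. A$i \<bullet> H (axis i 1))"
  using assms(1)
proof (induction S arbitrary: A rule: finite_induct)
  case empty
  then have "A $ i = 0" for i by (simp add: vec_eq_iff)
  then show ?case by simp
next
  case (insert k S)
  have sym: "A$i$j = A$j$i" for i j by (rule insert.prems)
  have psd: "0 \<le> v \<bullet> (A *v v)" for v by (rule insert.prems)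
  have col: "A *v axis i 1 = A $ i" for i
    using sym by (simp add: matrix_vector_mult_basis column_def vec_eq_iff)
  have selfadj: "v \<bullet> (A *v w) = w \<bullet> (A *v v)" for v w
  proof -
    have "transpose A = A" using sym by (simp add: transpose_def vec_eq_iff)
    then show ?thesis by (metis dot_lmul_matrix inner_commute vector_transpose_matrix)
  qed
  have quad: "0 \<le> v \<bullet> (A *v v) + 2 * t * (A$k \<bullet> v) + t\<^sup>2 * A$k$k" for v t
  proof -
    have "0 \<le> (v + t *\<^sub>R axis k 1) \<bullet> (A *v (v + t *\<^sub>R axis k 1))" by (rule psd)
    also have "\<dots> = v \<bullet> (A *v v) + t * (v \<bullet> (A *v axis k 1)) + t * (axis k 1 \<bullet> (A *v v)) 
       + t\<^sup>2 * (axis k 1 \<bullet> (A *v axis k 1))"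
      by (simp add: matrix_vector_right_distrib matrix_vector_mult_scaleR inner_add inner_scaleR power2_eq_square algebra_simps)
    also have "axis k 1 \<bullet> (A *v v) = v \<bullet> (A *v axis k 1)" by (rule selfadj)
    finally show ?thesis by (simp add: col inner_axis' inner_commute)
  qed
  have dk: "0 \<le> A$k$k" using psd[of "axis k 1"] by (simp add: col inner_axis')
  show ?case
  proof (cases "A$k$k = 0")
    case True
    \<comment> \<open>With a zero pivot the non-negative form is affine in \<open>t\<close>, hence constant.\<close>
    have "A$k \<bullet> v = 0" for v
    proof (rule ccontr)
      assume nz: "A$k \<bullet> v \<noteq> 0"
      define t where "t = - (v \<bullet> (A *v v) + 1) / (2 * (A$k \<bullet> v))"
      have "2 * t * (A$k \<bullet> v) = - (v \<bullet> (A *v v) + 1)" unfolding t_def using nz by (simp add: field_simps)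
      then show False using quad[of v t] True by simp
    qed
    then have "A$k = 0" using inner_eq_zero_iff by blast
    then have "\<And>i j. i \<notin> S \<Longrightarrow> A$i$j = 0" using insert.prems(3) by (metis insertE zero_index)
    then show ?thesis using insert.IH sym psd by blast
  next
    case False
    with dk have pos: "A$k$k > 0" by simp
    define B where "B = (\<chi> i j. A$i$j - A$k$i * A$k$j / A$k$k)"
    have Bi: "B $ i = A $ i - (A$k$i / A$k$k) *\<^sub>R A$k" for i
      by (simp add: B_def vec_eq_iff)
    have Bv: "B *v v = A *v v - ((A$k \<bullet> v) / A$k$k) *\<^sub>R A$k" for v
      by (simp add: vec_eq_iff matrix_vector_mul_component Bi inner_diff_left)
    have "0 \<le> (\<Sum>i\<in>UNIV. B$i \<bullet> H (axis i 1))"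
    proof (rule insert.IH)
      show "B$i$j = B$j$i" for i j by (simp add: B_def sym[of i j])
      show "0 \<le> v \<bullet> (B *v v)" for v
        using quad[of v "- (A$k \<bullet> v) / A$k$k"] pos
        by (simp add: Bv inner_diff_right inner_commute[of v "A$k"] power2_eq_square field_simps)
      show "i \<notin> S \<Longrightarrow> B$i$j = 0" for i j
        using insert.prems(3)[of i] sym[of i k] pos by (cases "i = k") (auto simp: B_def)
    qed
    moreover have "(\<Sum>i\<in>UNIV. (A$k$i / A$k$k) * (A$k \<bullet> H (axis i 1))) = (A$k \<bullet> H (A$k)) / A$k$k"
    proof -
      have "A$k = (\<Sum>i\<in>UNIV. A$k$i *\<^sub>R axis i 1)"
        by (metis (no_types, lifting) basis_expansion scalar_mult_eq_scaleR sum.cong)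
      then have "H (A$k) = (\<Sum>i\<in>UNIV. A$k$i *\<^sub>R H (axis i 1))"
        using linear_sum[OF assms(2)] linear_cmul[OF assms(2)] by (metis (no_types, lifting) sum.cong)
      then show ?thesis by (simp add: inner_sum_right sum_divide_distrib)
    qed
    moreover have "(A$k \<bullet> H (A$k)) / A$k$k \<ge> 0" using assms(3) pos by simp
    ultimately show ?thesis
      by (simp add: Bi inner_diff_left sum_subtractf)
  qed
qed

lemma trace_form_nonneg:
  fixes A :: "real^'n^'n" and H :: "real^'n \<Rightarrow> real^'n"
  assumes "linear H" "\<And>v. 0 \<le> v \<bullet> H v" "\<And>i j. A$i$j = A$j$i" "\<And>v. 0 \<le> v \<bullet> (A *v v)"
  shows "0 \<le> (\<Sum>i\<in>UNIV. A$i \<bullet> H (axis i 1))"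
  using trace_form_nonneg_aux[of UNIV H A] assms by simp

text \<open>The gradient field \<open>p\<close> and the second derivative \<open>H\<close> are arguments, so that barriers can be
  differentiated with the rules for \<open>has_derivative\<close>.\<close>

definition jet2_at :: "(real^'n \<Rightarrow> real) \<Rightarrow> (real^'n \<Rightarrow> real^'n) \<Rightarrow> (real^'n \<Rightarrow> real^'n) \<Rightarrow> real^'n \<Rightarrow> bool" where
  "jet2_at f p H x \<longleftrightarrow>
     (\<forall>\<^sub>F y in nhds x. (f has_derivative (\<lambda>v. p y \<bullet> v)) (at y)) \<and> (p has_derivative H) (at x)"

text \<open>The operator in non-divergence form: as \<open>H\<close> is the derivative of the gradient, the sum is the
  trace of \<open>A\<close> times the Hessian, and \<open>b\<close> is the drift.\<close>

definition ndop :: "real^'n^'n \<Rightarrow> real^'n \<Rightarrow> real^'n \<Rightarrow> (real^'n \<Rightarrow> real^'n) \<Rightarrow> real" where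
  "ndop A b p H = (\<Sum>i\<in>UNIV. A$i \<bullet> H (axis i 1)) + b \<bullet> p"

lemma jet2_at_has_derivative: "jet2_at f p H x \<Longrightarrow> (f has_derivative (\<lambda>v. p x \<bullet> v)) (at x)"
  unfolding jet2_at_def by (blast dest: eventually_nhds_x_imp_x)

lemma jet2_at_isCont: "jet2_at f p H x \<Longrightarrow> isCont f x"
  using jet2_at_has_derivative has_derivative_continuous by blast

lemma jet2_at_lin:
  assumes "jet2_at f p H x" "jet2_at f' p' H' x"
  shows "jet2_at (\<lambda>y. s * f y + t * f' y + k) (\<lambda>y. s *\<^sub>R p y + t *\<^sub>R p' y) (\<lambda>v. s *\<^sub>R H v + t *\<^sub>R H' v) x"
proof -
  have "\<forall>\<^sub>F y in nhds x. ((\<lambda>y. s * f y + t * f' y + k) has_derivative (\<lambda>v. (s *\<^sub>R p y + t *\<^sub>R p' y) \<bullet> v)) (at y)"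
    using assms[unfolded jet2_at_def, THEN conjunct1]
    by eventually_elim (auto intro!: derivative_eq_intros simp: inner_add_left)
  moreover have "((\<lambda>y. s *\<^sub>R p y + t *\<^sub>R p' y) has_derivative (\<lambda>v. s *\<^sub>R H v + t *\<^sub>R H' v)) (at x)"
    using assms[unfolded jet2_at_def, THEN conjunct2] by (auto intro!: derivative_eq_intros)
  ultimately show ?thesis by (simp add: jet2_at_def)
qed

lemma ndop_lin:
  "ndop A b (s *\<^sub>R p + t *\<^sub>R p') (\<lambda>v. s *\<^sub>R H v + t *\<^sub>R H' v) = s * ndop A b p H + t * ndop A b p' H'"
  by (simp add: ndop_def inner_add_right sum.distrib sum_distrib_left algebra_simps)

lemma jet2_at_affine:
  assumes "jet2_at f p H x"
  shows "jet2_at (\<lambda>y. s * f y + k) (\<lambda>y. s *\<^sub>R p y) (\<lambda>v. s *\<^sub>R H v) x"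
    and "ndop A b (s *\<^sub>R p x) (\<lambda>v. s *\<^sub>R H v) = s * ndop A b (p x) H"
  using jet2_at_lin[OF assms assms, of s 0 k] ndop_lin[of A b s "p x" 0 "p x" H H] by simp_all

lemma line_tendsto:
  fixes x v :: "'a::real_normed_vector"
  shows "((\<lambda>t. x + t *\<^sub>R v) \<longlongrightarrow> x) (nhds (0::real))"
proof -
  have "((\<lambda>t. x + t *\<^sub>R v) \<longlongrightarrow> x + 0 *\<^sub>R v) (nhds (0::real))"
    by (intro tendsto_intros filterlim_ident)
  then show ?thesis by simp
qed

lemma eventually_line_at_right:
  fixes x v :: "'a::real_normed_vector"
  assumes "open U" "x \<in> U"
  shows "\<forall>\<^sub>F t in at_right (0::real). x + t *\<^sub>R v \<in> U"
proof -
  have "\<forall>\<^sub>F y in nhds x. y \<in> U" using assms by (rule eventually_nhds_in_open)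
  then have "\<forall>\<^sub>F t in nhds (0::real). x + t *\<^sub>R v \<in> U"
    using line_tendsto[of x v] by (auto simp: filterlim_iff)
  then show ?thesis by (simp add: eventually_at_filter eventually_mono)
qed

lemma has_real_derivative_line:
  fixes x v :: "'a::real_inner"
  assumes "(f has_derivative (\<lambda>w. q \<bullet> w)) (at (x + t *\<^sub>R v))"
  shows "((\<lambda>t. f (x + t *\<^sub>R v)) has_real_derivative q \<bullet> v) (at t)"
proof -
  have "((\<lambda>t. f (x + t *\<^sub>R v)) has_derivative (\<lambda>s. q \<bullet> (s *\<^sub>R v))) (at t)"
    by (rule has_derivative_compose[of "\<lambda>t. x + t *\<^sub>R v" _ t _ f, OF _ assms]) (auto intro!: derivative_eq_intros)
  then show ?thesis unfolding has_field_derivative_def by (rule has_derivative_eq_rhs) (auto simp: mult.commute)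
qed

lemma jet2_at_compose:
  fixes v :: "real^'n"
  assumes "jet2_at f p H x"
  shows "\<forall>\<^sub>F t in nhds 0. ((\<lambda>t. f (x + t *\<^sub>R v)) has_real_derivative p (x + t *\<^sub>R v) \<bullet> v) (at t)"
    and "((\<lambda>t. p (x + t *\<^sub>R v) \<bullet> v) has_real_derivative v \<bullet> H v) (at 0)"
proof -
  have "\<forall>\<^sub>F t in nhds 0. (f has_derivative (\<lambda>w. p (x + t *\<^sub>R v) \<bullet> w)) (at (x + t *\<^sub>R v))"
    using assms line_tendsto[of x v] unfolding jet2_at_def by (auto simp: filterlim_iff)
  then show "\<forall>\<^sub>F t in nhds 0. ((\<lambda>t. f (x + t *\<^sub>R v)) has_real_derivative p (x + t *\<^sub>R v) \<bullet> v) (at t)"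
  proof eventually_elim
    case (elim t)
    then show ?case by (rule has_real_derivative_line)
  qed
  have pd: "(p has_derivative H) (at (x + 0 *\<^sub>R v))" and lin: "linear H"
    using assms unfolding jet2_at_def by (auto dest: has_derivative_linear)
  have "((\<lambda>t. p (x + t *\<^sub>R v)) has_derivative (\<lambda>s. H (s *\<^sub>R v))) (at 0)"
    by (rule has_derivative_compose[of "\<lambda>t. x + t *\<^sub>R v" _ 0 _ p, OF _ pd]) (auto intro!: derivative_eq_intros)
  then have "((\<lambda>t. p (x + t *\<^sub>R v) \<bullet> v) has_derivative (\<lambda>s. H (s *\<^sub>R v) \<bullet> v)) (at 0)"
    by (auto intro!: derivative_eq_intros)
  then show "((\<lambda>t. p (x + t *\<^sub>R v) \<bullet> v) has_real_derivative v \<bullet> H v) (at 0)"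
    unfolding has_field_derivative_def 
    by (rule has_derivative_eq_rhs) (auto simp: linear_cmul[OF lin] inner_commute mult.commute)
qed

text \<open>If \<open>v \<bullet> H v\<close> were negative, the slope of \<open>f\<close> along \<open>v\<close>, which vanishes at \<open>x\<close>, would be negative
  just after \<open>x\<close>, and \<open>f\<close> would fall below its minimum by the mean value theorem.\<close>

lemma jet2_local_min:
  assumes j: "jet2_at f p H x" and min: "\<forall>\<^sub>F y in nhds x. f x \<le> f y"
  shows "p x = 0" and "0 \<le> v \<bullet> H v"
proof -
  show p0: "p x = 0"
  proof -
    have "\<forall>\<^sub>F y in at x. f x \<le> f y" using min by (simp add: eventually_at_filter eventually_mono)
    with jet2_at_has_derivative[OF j] have "(\<lambda>v. p x \<bullet> v) = (\<lambda>v. 0)" by (rule has_derivative_local_min)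
    then show ?thesis by (metis inner_eq_zero_iff)
  qed
  show "0 \<le> v \<bullet> H v"
  proof (rule ccontr)
    assume "\<not> 0 \<le> v \<bullet> H v"
    then have neg: "v \<bullet> H v < 0" by simp
    obtain d where d: "d > 0" "\<And>t. 0 < t \<Longrightarrow> t < d \<Longrightarrow> p (x + t *\<^sub>R v) \<bullet> v < 0"
      using has_real_derivative_neg_dec_right[OF jet2_at_compose(2)[OF j] neg] p0 by auto
    have "\<forall>\<^sub>F t in nhds 0. f x \<le> f (x + t *\<^sub>R v)" using min line_tendsto[of x v] by (auto simp: filterlim_iff)
    from eventually_conj[OF this jet2_at_compose(1)[OF j, of v]]
    obtain e where e: "e > 0" "\<And>t. \<bar>t\<bar> < e \<Longrightarrow> f x \<le> f (x + t *\<^sub>R v)"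
      "\<And>t. \<bar>t\<bar> < e \<Longrightarrow> ((\<lambda>t. f (x + t *\<^sub>R v)) has_real_derivative p (x + t *\<^sub>R v) \<bullet> v) (at t)"
      by (auto simp: eventually_nhds_metric dist_real_def)
    define t where "t = min d e / 2"
    have t: "0 < t" "t < d" "t < e" using d e by (auto simp: t_def)
    obtain z where z: "0 < z" "z < t"
        "f (x + t *\<^sub>R v) - f (x + 0 *\<^sub>R v) = (t - 0) * (p (x + z *\<^sub>R v) \<bullet> v)"
      using MVT2[OF t(1), of "\<lambda>t. f (x + t *\<^sub>R v)" "\<lambda>t. p (x + t *\<^sub>R v) \<bullet> v"] e t by fastforce
    have "p (x + z *\<^sub>R v) \<bullet> v < 0" using d z t by auto
    then have "f (x + t *\<^sub>R v) < f x" using z t by (smt (verit) mult_pos_neg scaleR_zero_left add.right_neutral)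
    then show False using e(2)[of t] t by auto
  qed
qed

lemma ndop_local_min_nonneg:
  assumes j: "jet2_at f p H x" and min: "\<forall>\<^sub>F y in nhds x. f x \<le> f y"
    and "\<And>i j. A$i$j = A$j$i" "\<And>v. 0 \<le> v \<bullet> (A *v v)"
  shows "0 \<le> ndop A b (p x) H"
proof -
  have "linear H" using j unfolding jet2_at_def by (auto dest: has_derivative_linear)
  then show ?thesis
    using trace_form_nonneg[OF _ jet2_local_min(2)[OF j min] assms(3,4)] jet2_local_min(1)[OF j min]
    by (simp add: ndop_def)
qed

section \<open>The Hopf lemma for a hypersurface\<close>

text \<open>The trace stands for the size of \<open>A\<close>: it dominates every entry of a positive semidefinite matrix.\<close>

definition elliptic_bound :: "real \<Rightarrow> real \<Rightarrow> real^'n^'n \<Rightarrow> real^'n \<Rightarrow> bool" where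
  "elliptic_bound c C A b \<longleftrightarrow>
     (\<forall>i j. A$i$j = A$j$i) \<and> (\<forall>v. c * (norm v)\<^sup>2 \<le> v \<bullet> (A *v v)) \<and> (\<Sum>i\<in>UNIV. A$i$i) \<le> C \<and> norm b \<le> C"

lemma jet2_at_barrier:
  assumes "jet2_at r p H x"
  shows "jet2_at (\<lambda>y. r y + K * (r y)\<^sup>2 - (norm (y - z))\<^sup>2)
     (\<lambda>y. (1 + 2 * K * r y) *\<^sub>R p y - 2 *\<^sub>R (y - z))
     (\<lambda>v. (1 + 2 * K * r x) *\<^sub>R H v + (2 * K * (p x \<bullet> v)) *\<^sub>R p x - 2 *\<^sub>R v) x"
proof -
  have "\<forall>\<^sub>F y in nhds x. ((\<lambda>y. r y + K * (r y)\<^sup>2 - (norm (y - z))\<^sup>2) has_derivative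
     (\<lambda>v. ((1 + 2 * K * r y) *\<^sub>R p y - 2 *\<^sub>R (y - z)) \<bullet> v)) (at y)"
    using assms[unfolded jet2_at_def, THEN conjunct1]
    unfolding power2_norm_eq_inner
    by eventually_elim (auto intro!: derivative_eq_intros simp: fun_eq_iff inner_add_left inner_diff_left algebra_simps inner_commute)
  moreover have "((\<lambda>y. (1 + 2 * K * r y) *\<^sub>R p y - 2 *\<^sub>R (y - z)) has_derivative
     (\<lambda>v. (1 + 2 * K * r x) *\<^sub>R H v + (2 * K * (p x \<bullet> v)) *\<^sub>R p x - 2 *\<^sub>R v)) (at x)"
  proof -
    have [derivative_intros]: "(p has_derivative H) (at x)"
      "(r has_derivative (\<lambda>v. p x \<bullet> v)) (at x)"
      using assms jet2_at_has_derivative[OF assms] by (auto simp: jet2_at_def)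
    show ?thesis
      by (auto intro!: derivative_eq_intros simp: fun_eq_iff)
  qed
  ultimately show ?thesis by (simp add: jet2_at_def)
qed

lemma ndop_barrier:
  "ndop A b (s *\<^sub>R p - 2 *\<^sub>R q) (\<lambda>v. s *\<^sub>R H v + (t * (p \<bullet> v)) *\<^sub>R p - 2 *\<^sub>R v) =
     s * ndop A b p H + t * (p \<bullet> (A *v p)) - 2 * (\<Sum>i\<in>UNIV. A$i$i) - 2 * (b \<bullet> q)"
proof -
  have "p \<bullet> (A *v p) = (\<Sum>i\<in>UNIV. p$i * (A$i \<bullet> p))"
    by (simp add: inner_vec_def[of p] matrix_vector_mul_component)
  then show ?thesis
    by (simp add: ndop_def inner_diff_right inner_add_right inner_axis sum.distrib sum_subtractf
        sum_distrib_left algebra_simps)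
qed

text \<open>Applied to \<open>\<rho> + K \<rho>\<^sup>2 - |x - x0|\<^sup>2\<close>, the operator produces \<open>2 K (P x \<bullet> A P x)\<close>, which is bounded
  below by a multiple of \<open>K\<close> near \<open>x0\<close>, plus terms that stay bounded once \<open>K \<rho> \<le> 1/2\<close>. So
  \<open>K\<close> is chosen first and the radius \<open>r\<close> afterwards.\<close>

lemma hopf_barrier_positive:
  fixes x0 :: "real^'n"
  assumes "0 < c" "0 \<le> C" "0 \<le> Q" "0 < s"
    and rho: "\<And>x. x \<in> ball x0 s \<Longrightarrow> jet2_at \<rho> P (H x) x" "\<rho> x0 = 0" "P x0 \<noteq> 0"
    and ell: "\<And>x. x \<in> ball x0 s \<Longrightarrow> 0 < \<rho> x \<Longrightarrow> elliptic_bound c C (A x) (b x)"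
    and bd: "\<And>x. x \<in> ball x0 s \<Longrightarrow> 0 < \<rho> x \<Longrightarrow> \<bar>ndop (A x) (b x) (P x) (H x)\<bar> \<le> C"
  obtains K r where "0 < K" "0 < r" "cball x0 r \<subseteq> ball x0 s"
    "\<And>x. x \<in> cball x0 r \<Longrightarrow> 0 \<le> \<rho> x \<Longrightarrow> \<rho> x + K * (\<rho> x)\<^sup>2 - (norm (x - x0))\<^sup>2 \<le> 2"
    "\<And>x. x \<in> cball x0 r \<Longrightarrow> 0 < \<rho> x \<Longrightarrow>
       Q * (\<rho> x + K * (\<rho> x)\<^sup>2 - (norm (x - x0))\<^sup>2) <
       ndop (A x) (b x) ((1 + 2 * K * \<rho> x) *\<^sub>R P x - 2 *\<^sub>R (x - x0))
         (\<lambda>v. (1 + 2 * K * \<rho> x) *\<^sub>R H x v + (2 * K * (P x \<bullet> v)) *\<^sub>R P x - 2 *\<^sub>R v)"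
proof -
  define m where "m = (norm (P x0))\<^sup>2 / 2"
  have m: "m > 0" using rho by (simp add: m_def)
  \<comment> \<open>The remaining terms cost at most \<open>2 C\<close> each for \<open>\<rho>\<close>, for the trace and for the drift, and
      \<open>Q\<close> times the barrier costs at most \<open>2 Q\<close>.\<close>
  define K where "K = (6 * C + 2 * Q + 1) / (2 * c * m)"
  have K: "K > 0" "2 * K * c * m = 6 * C + 2 * Q + 1"
    using m assms(1-3) by (auto simp: K_def field_simps intro!: divide_pos_pos add_nonneg_pos)
  have j0: "jet2_at \<rho> P (H x0) x0" using rho(1) \<open>0 < s\<close> by simp
  have cont: "isCont \<rho> x0" "isCont P x0"
    using jet2_at_isCont[OF j0] j0 has_derivative_continuous by (auto simp: jet2_at_def)
  have l1: "(\<rho> \<longlongrightarrow> 0) (nhds x0)"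
    using cont(1) rho(2) tendsto_at_iff_tendsto_nhds[of \<rho> x0] by (simp add: isCont_def)
  have l2: "((\<lambda>x. (norm (P x))\<^sup>2) \<longlongrightarrow> (norm (P x0))\<^sup>2) (nhds x0)"
    using cont(2) tendsto_at_iff_tendsto_nhds[of P x0] by (intro tendsto_intros) (simp add: isCont_def)
  have "\<forall>\<^sub>F x in nhds x0. \<rho> x < min 1 (1 / (2 * K))"
    using order_tendstoD(2)[OF l1, of "min 1 (1 / (2 * K))"] K(1) by simp
  moreover have "\<forall>\<^sub>F x in nhds x0. m < (norm (P x))\<^sup>2"
    using order_tendstoD(1)[OF l2, of m] rho(3) by (simp add: m_def)
  moreover have "\<forall>\<^sub>F x in nhds x0. x \<in> ball x0 (min s 1)"
    using \<open>0 < s\<close> by (intro eventually_nhds_in_open) auto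
  ultimately have "\<forall>\<^sub>F x in nhds x0. \<rho> x < min 1 (1 / (2 * K)) \<and> m < (norm (P x))\<^sup>2 \<and> x \<in> ball x0 (min s 1)"
    by eventually_elim simp
  then obtain d where d: "d > 0" "\<And>x. dist x x0 < d \<Longrightarrow>
      \<rho> x < min 1 (1 / (2 * K)) \<and> m < (norm (P x))\<^sup>2 \<and> x \<in> ball x0 (min s 1)"
    by (auto simp: eventually_nhds_metric)
  define r where "r = d / 2"
  have in_r: "\<rho> x < 1" "2 * K * \<rho> x < 1" "m < (norm (P x))\<^sup>2" "x \<in> ball x0 s" "norm (x - x0) \<le> 1"
    if "x \<in> cball x0 r" for x
  proof -
    have "dist x x0 < d" using that d(1) by (auto simp: r_def dist_commute)
    from d(2)[OF this] show "\<rho> x < 1" "2 * K * \<rho> x < 1" "m < (norm (P x))\<^sup>2" "x \<in> ball x0 s" "norm (x - x0) \<le> 1"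
      using K(1) by (auto simp: field_simps dist_norm norm_minus_commute)
  qed
  have h2: "\<rho> x + K * (\<rho> x)\<^sup>2 - (norm (x - x0))\<^sup>2 \<le> 2" if "x \<in> cball x0 r" "0 \<le> \<rho> x" for x
  proof -
    have "K * (\<rho> x)\<^sup>2 = (K * \<rho> x) * \<rho> x" by (simp add: power2_eq_square)
    also have "\<dots> \<le> 1 * 1"
      using in_r(1,2)[OF that(1)] that(2) K by (intro mult_mono) auto
    finally show ?thesis using in_r(1)[OF that(1)] zero_le_power2[of "norm (x - x0)"] by linarith
  qed
  show thesis
  proof (rule that[of K r])
    show "0 < K" "0 < r" by (use K d in \<open>auto simp: r_def\<close>)
    show "cball x0 r \<subseteq> ball x0 s" using in_r(4) by blast
    show "\<rho> x + K * (\<rho> x)\<^sup>2 - (norm (x - x0))\<^sup>2 \<le> 2" if "x \<in> cball x0 r" "0 \<le> \<rho> x" for x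
      by (rule h2[OF that])
    fix x assume x: "x \<in> cball x0 r" "0 < \<rho> x"
    note e = ell[OF in_r(4)[OF x(1)] x(2), unfolded elliptic_bound_def]
    have s: "- (2 * C) \<le> (1 + 2 * K * \<rho> x) * ndop (A x) (b x) (P x) (H x)"
    proof -
      have "\<bar>(1 + 2 * K * \<rho> x) * ndop (A x) (b x) (P x) (H x)\<bar> \<le> 2 * C"
        unfolding abs_mult using bd[OF in_r(4)[OF x(1)] x(2)] in_r(2)[OF x(1)] x(2) K \<open>0 \<le> C\<close>
        by (intro mult_mono) auto
      then show ?thesis by linarith
    qed
    have t: "2 * K * (P x \<bullet> (A x *v P x)) \<ge> 6 * C + 2 * Q + 1"
    proof -
      have "c * m \<le> c * (norm (P x))\<^sup>2" using in_r(3)[OF x(1)] assms(1) by simp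
      also have "\<dots> \<le> P x \<bullet> (A x *v P x)" using e by blast
      finally have "2 * K * (c * m) \<le> 2 * K * (P x \<bullet> (A x *v P x))" using K(1) by simp
      then show ?thesis using K(2) by (simp add: mult.assoc)
    qed
    have u: "b x \<bullet> (x - x0) \<le> C"
    proof -
      have "b x \<bullet> (x - x0) \<le> norm (b x) * norm (x - x0)" by (rule norm_cauchy_schwarz)
      also have "\<dots> \<le> C * 1" using e in_r(5)[OF x(1)] assms(2) by (intro mult_mono) auto
      finally show ?thesis by simp
    qed
    have "Q * (\<rho> x + K * (\<rho> x)\<^sup>2 - (norm (x - x0))\<^sup>2) \<le> Q * 2"
      using h2[OF x(1)] x(2) assms(3) by (intro mult_left_mono) auto
    with s t u e show "Q * (\<rho> x + K * (\<rho> x)\<^sup>2 - (norm (x - x0))\<^sup>2) <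
       ndop (A x) (b x) ((1 + 2 * K * \<rho> x) *\<^sub>R P x - 2 *\<^sub>R (x - x0))
         (\<lambda>v. (1 + 2 * K * \<rho> x) *\<^sub>R H x v + (2 * K * (P x \<bullet> v)) *\<^sub>R P x - 2 *\<^sub>R v)"
      unfolding ndop_barrier by linarith
  qed
qed

lemma compact_nonneg_part:
  fixes f :: "'a::t2_space \<Rightarrow> real"
  assumes "compact S" "continuous_on S f"
  shows "compact {x \<in> S. 0 \<le> f x}"
proof -
  have "closed (S \<inter> f -` {0..})"
    by (rule continuous_closed_preimage[OF assms(2) compact_imp_closed[OF assms(1)] closed_atLeast])
  then have "compact (S \<inter> (S \<inter> f -` {0..}))" using assms(1) by (rule compact_Int_closed[rotated])
  moreover have "S \<inter> (S \<inter> f -` {0..}) = {x \<in> S. 0 \<le> f x}" by auto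
  ultimately show ?thesis by simp
qed

text \<open>Comparison of \<open>w\<close> with a small multiple \<open>e\<close> of the barrier \<open>h\<close> on the compact region \<open>S\<close> cut out by
  \<open>0 \<le> \<rho>\<close> and a small ball. Where \<open>\<rho> = 0\<close> the barrier is non-positive. On the sphere it is
  non-negative only where \<open>\<rho> > 0\<close>, so \<open>w\<close> is bounded away from 0 on that part by compactness, which
  fixes \<open>e\<close>. A negative minimum of \<open>w - e h\<close> inside would contradict the strict inequality for the
  barrier. In the conclusion the non-negative term \<open>K \<rho>\<^sup>2\<close> of the barrier is dropped.\<close>

lemma hopf_barrier_bound:
  fixes x0 :: "real^'n"
  assumes "0 < c" "0 \<le> C" "0 \<le> Q" "0 < s"
    and rho: "\<And>x. x \<in> ball x0 s \<Longrightarrow> jet2_at \<rho> P (H x) x" "\<rho> x0 = 0" "P x0 \<noteq> 0"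
    and ell: "\<And>x. x \<in> ball x0 s \<Longrightarrow> 0 < \<rho> x \<Longrightarrow> elliptic_bound c C (A x) (b x)"
    and bd: "\<And>x. x \<in> ball x0 s \<Longrightarrow> 0 < \<rho> x \<Longrightarrow> \<bar>ndop (A x) (b x) (P x) (H x)\<bar> \<le> C"
    and cw: "continuous_on (ball x0 s \<inter> {x. 0 \<le> \<rho> x}) w"
    and w0: "\<And>x. x \<in> ball x0 s \<Longrightarrow> \<rho> x = 0 \<Longrightarrow> 0 \<le> w x"
    and wpos: "\<And>x. x \<in> ball x0 s \<Longrightarrow> 0 < \<rho> x \<Longrightarrow> 0 < w x"
    and jw: "\<And>x. x \<in> ball x0 s \<Longrightarrow> 0 < \<rho> x \<Longrightarrow> jet2_at w W (Hw x) x"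
    and Lw: "\<And>x. x \<in> ball x0 s \<Longrightarrow> 0 < \<rho> x \<Longrightarrow> ndop (A x) (b x) (W x) (Hw x) \<le> Q * w x"
  obtains e r where "0 < e" "0 < r" "r \<le> s"
    "\<And>x. x \<in> ball x0 r \<Longrightarrow> 0 < \<rho> x \<Longrightarrow> e * (\<rho> x - (norm (x - x0))\<^sup>2) \<le> w x"
proof -
  obtain K r where K: "0 < K" and r: "0 < r" and sub: "cball x0 r \<subseteq> ball x0 s"
    and h2: "\<And>x. x \<in> cball x0 r \<Longrightarrow> 0 \<le> \<rho> x \<Longrightarrow> \<rho> x + K * (\<rho> x)\<^sup>2 - (norm (x - x0))\<^sup>2 \<le> 2"
    and Lh: "\<And>x. x \<in> cball x0 r \<Longrightarrow> 0 < \<rho> x \<Longrightarrow>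
       Q * (\<rho> x + K * (\<rho> x)\<^sup>2 - (norm (x - x0))\<^sup>2) <
       ndop (A x) (b x) ((1 + 2 * K * \<rho> x) *\<^sub>R P x - 2 *\<^sub>R (x - x0))
         (\<lambda>v. (1 + 2 * K * \<rho> x) *\<^sub>R H x v + (2 * K * (P x \<bullet> v)) *\<^sub>R P x - 2 *\<^sub>R v)"
    by (rule hopf_barrier_positive[of c C Q s x0 \<rho> P H A b, OF assms(1-9)]) (assumption | (rule that; simp))+
  define h where "h = (\<lambda>x. \<rho> x + K * (\<rho> x)\<^sup>2 - (norm (x - x0))\<^sup>2)"
  have c\<rho>: "continuous_on (cball x0 r) \<rho>"
    using jet2_at_isCont[OF rho(1)] sub by (intro continuous_at_imp_continuous_on) blast
  have ch: "continuous_on (cball x0 r) h"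
    unfolding h_def by (intro continuous_intros c\<rho>)
  define S where "S = {x \<in> cball x0 r. 0 \<le> \<rho> x}"
  have S: "compact S" 
    unfolding S_def by (rule compact_nonneg_part[OF compact_cball c\<rho>])
  have cwS: "continuous_on S w" by (rule continuous_on_subset[OF cw]) (use sub in \<open>auto simp: S_def\<close>)
  have chS: "continuous_on S h" by (rule continuous_on_subset[OF ch]) (auto simp: S_def)
  have w_nonneg: "0 \<le> w x" if "x \<in> S" for x
    using w0[of x] wpos[of x] that sub by (fastforce simp: S_def)
  have rho_pos: "0 < \<rho> x" if "x \<in> S" "0 < h x" for x
    using that by (cases "\<rho> x = 0") (auto simp: S_def h_def)
  \<comment> \<open>The part of the sphere on which the barrier could exceed \<open>w\<close>.\<close>
  define T where "T = {x \<in> S. 0 \<le> h x} \<inter> sphere x0 r"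
  obtain e where e: "0 < e" "\<And>x. x \<in> T \<Longrightarrow> e * h x \<le> w x"
  proof (cases "T = {}")
    case True then show ?thesis using that[of 1] by auto
  next
    case False
    have "compact T" unfolding T_def
      by (intro compact_Int_closed compact_nonneg_part S chS) auto
    moreover have "continuous_on T w" by (rule continuous_on_subset[OF cwS]) (auto simp: T_def)
    ultimately obtain y where y: "y \<in> T" "\<And>x. x \<in> T \<Longrightarrow> w y \<le> w x"
      using continuous_attains_inf[of T w] False by blast
    have "0 < \<rho> y"
    proof (rule ccontr)
      assume "\<not> 0 < \<rho> y"
      then have "\<rho> y = 0" using y by (auto simp: T_def S_def)
      then have "h y < 0" using y(1) r by (auto simp: h_def T_def dist_norm)
      then show False using y(1) by (auto simp: T_def)
    qed
    then have wy: "0 < w y" using wpos[of y] y(1) sub by (auto simp: T_def S_def)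
    show ?thesis
    proof (rule that[of "w y / 2"])
      fix x assume x: "x \<in> T"
      then have "h x \<le> 2" using h2[of x] by (auto simp: T_def S_def h_def)
      then have "w y / 2 * h x \<le> w y / 2 * 2" using wy by (intro mult_left_mono) auto
      then show "w y / 2 * h x \<le> w x" using y(2)[OF x] by simp
    qed (use wy in simp)
  qed
  have main: "e * h x \<le> w x" if "x \<in> S" for x
  proof -
    have "continuous_on S (\<lambda>x. w x - e * h x)" by (intro continuous_intros cwS chS)
    moreover have "S \<noteq> {}" using that by blast
    ultimately obtain y where y: "y \<in> S" "\<And>x. x \<in> S \<Longrightarrow> w y - e * h y \<le> w x - e * h x"
      using continuous_attains_inf[OF S, of "\<lambda>x. w x - e * h x"] by auto
    have "0 \<le> w y - e * h y"
    proof (rule ccontr)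
      assume neg: "\<not> 0 \<le> w y - e * h y"
      then have hy: "0 < h y" using w_nonneg[OF y(1)] e(1) by (smt (verit) mult_nonneg_nonpos)
      have py: "0 < \<rho> y" by (rule rho_pos[OF y(1) hy])
      have "y \<notin> T" using e(2) neg by fastforce
      then have yb: "y \<in> ball x0 r" using y(1) hy by (auto simp: T_def S_def)
      have yc: "y \<in> cball x0 r" "y \<in> ball x0 s" using yb sub ball_subset_cball by blast+
      have jh: "jet2_at h (\<lambda>y. (1 + 2 * K * \<rho> y) *\<^sub>R P y - 2 *\<^sub>R (y - x0))
        (\<lambda>v. (1 + 2 * K * \<rho> y) *\<^sub>R H y v + (2 * K * (P y \<bullet> v)) *\<^sub>R P y - 2 *\<^sub>R v) y" (is "jet2_at h ?p ?H y")
        unfolding h_def by (rule jet2_at_barrier[OF rho(1)[OF yc(2)]])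
      note jj = jet2_at_lin[OF jw[OF yc(2) py] jh, of 1 "- e" 0]
      have "\<forall>\<^sub>F x in nhds y. x \<in> ball x0 r"
        using yb by (intro eventually_nhds_in_open) auto
      moreover have "\<forall>\<^sub>F x in nhds y. 0 < \<rho> x"
        using jet2_at_isCont[OF rho(1)[OF yc(2)]] py tendsto_at_iff_tendsto_nhds[of \<rho> y]
        by (intro order_tendstoD(1)[of \<rho> "\<rho> y"]) (simp_all add: isCont_def)
      ultimately have mi: "\<forall>\<^sub>F x in nhds y. 1 * w y + (-e) * h y + 0 \<le> 1 * w x + (-e) * h x + 0"
      proof eventually_elim
        case (elim x)
        then show ?case using y(2)[of x] by (auto simp: S_def)
      qed
      have el: "elliptic_bound c C (A y) (b y)" by (rule ell[OF yc(2) py])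
      have "0 \<le> ndop (A y) (b y) (1 *\<^sub>R W y + (-e) *\<^sub>R ?p y) (\<lambda>v. 1 *\<^sub>R Hw y v + (-e) *\<^sub>R ?H v)"
      proof (rule ndop_local_min_nonneg[OF jj mi])
        show "A y $ i $ j = A y $ j $ i" for i j using el by (simp add: elliptic_bound_def)
        show "0 \<le> v \<bullet> (A y *v v)" for v
          using el \<open>0 < c\<close> unfolding elliptic_bound_def by (smt (verit) mult_nonneg_nonneg zero_le_power2)
      qed
      then have "e * ndop (A y) (b y) (?p y) ?H \<le> ndop (A y) (b y) (W y) (Hw y)"
        unfolding ndop_lin by simp
      also have "\<dots> \<le> Q * w y" by (rule Lw[OF yc(2) py])
      also have "\<dots> \<le> Q * (e * h y)" using neg assms(3) by (intro mult_left_mono) auto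
      also have "\<dots> = e * (Q * h y)" by simp
      also have "\<dots> < e * ndop (A y) (b y) (?p y) ?H"
        using Lh[OF yc(1) py] e(1) unfolding h_def by (intro mult_strict_left_mono)
      finally show False by simp
    qed
    then show ?thesis using y(2)[OF that] by linarith
  qed
  show thesis
  proof (rule that[of e r])
    show "r \<le> s" using sub r by (simp add: cball_subset_ball_iff)
    fix x assume x: "x \<in> ball x0 r" "0 < \<rho> x"
    have "e * (\<rho> x - (norm (x - x0))\<^sup>2) \<le> e * h x" using K e(1) by (intro mult_left_mono) (auto simp: h_def)
    also have "\<dots> \<le> w x" using x by (intro main) (auto simp: S_def)
    finally show "e * (\<rho> x - (norm (x - x0))\<^sup>2) \<le> w x" .
  qed (use e r in auto)
qed

text \<open>Along a direction \<open>v\<close> that enters \<open>{\<rho> > 0}\<close> the function \<open>\<rho>\<close> grows linearly and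
  \<open>|x - x0|\<^sup>2\<close> only quadratically, so the barrier bound becomes a linear lower bound for \<open>w\<close>.\<close>

lemma hopf:
  fixes x0 :: "real^'n"
  assumes "0 < c" "0 \<le> C" "0 \<le> Q" "0 < s"
    and rho: "\<And>x. x \<in> ball x0 s \<Longrightarrow> jet2_at \<rho> P (H x) x" "\<rho> x0 = 0" 
    and ell: "\<And>x. x \<in> ball x0 s \<Longrightarrow> 0 < \<rho> x \<Longrightarrow> elliptic_bound c C (A x) (b x)"
    and bd: "\<And>x. x \<in> ball x0 s \<Longrightarrow> 0 < \<rho> x \<Longrightarrow> \<bar>ndop (A x) (b x) (P x) (H x)\<bar> \<le> C"
    and cw: "continuous_on (ball x0 s \<inter> {x. 0 \<le> \<rho> x}) w"
    and w0: "\<And>x. x \<in> ball x0 s \<Longrightarrow> \<rho> x = 0 \<Longrightarrow> 0 \<le> w x"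
    and wpos: "\<And>x. x \<in> ball x0 s \<Longrightarrow> 0 < \<rho> x \<Longrightarrow> 0 < w x"
    and jw: "\<And>x. x \<in> ball x0 s \<Longrightarrow> 0 < \<rho> x \<Longrightarrow> jet2_at w W (Hw x) x"
    and Lw: "\<And>x. x \<in> ball x0 s \<Longrightarrow> 0 < \<rho> x \<Longrightarrow> ndop (A x) (b x) (W x) (Hw x) \<le> Q * w x"
    and dir: "0 < P x0 \<bullet> v"
  shows "\<exists>e>0. \<forall>\<^sub>F t in at_right 0. e * t \<le> w (x0 + t *\<^sub>R v)"
proof -
  have "P x0 \<noteq> 0" using dir by auto
  then obtain e r where e: "0 < e" "0 < r" "r \<le> s" 
    and er: "\<And>x. x \<in> ball x0 r \<Longrightarrow> 0 < \<rho> x \<Longrightarrow> e * (\<rho> x - (norm (x - x0))\<^sup>2) \<le> w x"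
    using hopf_barrier_bound[of c C Q s x0 \<rho> P H A b w W Hw, OF assms(1-6) _ assms(7-13)] by blast
  have sq: "((\<lambda>t. (norm (t *\<^sub>R v))\<^sup>2) has_real_derivative 0) (at 0)"
    unfolding power2_norm_eq_inner by (auto intro!: derivative_eq_intros)
  have "jet2_at \<rho> P (H x0) x0" using rho(1) \<open>0 < s\<close> by simp
  from jet2_at_compose(1)[OF this, of v, THEN eventually_nhds_x_imp_x]
  have "((\<lambda>t. \<rho> (x0 + t *\<^sub>R v)) has_real_derivative P x0 \<bullet> v) (at 0)" by simp
  from DERIV_diff[OF DERIV_diff[OF this sq] DERIV_cmult_Id[of "P x0 \<bullet> v / 2"]]
  have "((\<lambda>t. \<rho> (x0 + t *\<^sub>R v) - (norm (t *\<^sub>R v))\<^sup>2 - (P x0 \<bullet> v / 2) * t)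
      has_real_derivative P x0 \<bullet> v - 0 - P x0 \<bullet> v / 2) (at 0)" .
  from has_real_derivative_pos_inc_right[OF this] dir rho(2)
  obtain d where d: "d > 0" "\<And>t. 0 < t \<Longrightarrow> t < d \<Longrightarrow> (P x0 \<bullet> v / 2) * t < \<rho> (x0 + t *\<^sub>R v) - (norm (t *\<^sub>R v))\<^sup>2"
    by auto
  have "\<forall>\<^sub>F t in at_right 0. x0 + t *\<^sub>R v \<in> ball x0 r"
    using e(2) by (intro eventually_line_at_right) auto
  moreover have "\<forall>\<^sub>F t in at_right 0. t \<in> {0<..<d}" by (rule eventually_at_rightI[OF _ d(1)]) auto
  ultimately have "\<forall>\<^sub>F t in at_right 0. (e * (P x0 \<bullet> v / 2)) * t \<le> w (x0 + t *\<^sub>R v)"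
  proof eventually_elim
    case (elim t)
    have 1: "(P x0 \<bullet> v / 2) * t < \<rho> (x0 + t *\<^sub>R v) - (norm (t *\<^sub>R v))\<^sup>2" using d(2) elim by auto
    have "0 < (P x0 \<bullet> v / 2) * t" using elim dir by simp
    with 1 have "0 < \<rho> (x0 + t *\<^sub>R v)" using zero_le_power2[of "norm (t *\<^sub>R v)"] by linarith
    from er[OF _ this] elim have "e * (\<rho> (x0 + t *\<^sub>R v) - (norm (t *\<^sub>R v))\<^sup>2) \<le> w (x0 + t *\<^sub>R v)" by simp
    moreover have "e * ((P x0 \<bullet> v / 2) * t) \<le> e * (\<rho> (x0 + t *\<^sub>R v) - (norm (t *\<^sub>R v))\<^sup>2)"
      using 1 e(1) by (intro mult_left_mono) auto
    ultimately show ?case unfolding mult.assoc by linarith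
  qed
  moreover have "0 < e * (P x0 \<bullet> v / 2)" using e dir by simp
  ultimately show ?thesis by blast
qed

section \<open>Minimum principles\<close>

lemma elliptic_bound_trace_nonneg:
  assumes "elliptic_bound c C A b" "0 < c"
  shows "0 \<le> (\<Sum>i\<in>UNIV. A$i$i)"
proof (rule sum_nonneg)
  fix i
  have "c * (norm (axis i (1::real)))\<^sup>2 \<le> axis i 1 \<bullet> (A *v axis i 1)"
    using assms(1) unfolding elliptic_bound_def by blast
  then show "0 \<le> A$i$i"
    using assms(2) by (simp add: matrix_vector_mult_basis column_def inner_axis')
qed

lemma jet2_at_sphere:
  "jet2_at (\<lambda>x. R\<^sup>2 - (norm (x - z))\<^sup>2) (\<lambda>x. - 2 *\<^sub>R (x - z)) (\<lambda>v. - 2 *\<^sub>R v) x"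
  unfolding jet2_at_def power2_norm_eq_inner
  by (auto intro!: derivative_eq_intros always_eventually simp: fun_eq_iff inner_diff_left algebra_simps inner_commute)

text \<open>With \<open>\<rho> = R\<^sup>2 - |x - z|\<^sup>2\<close> the Hopf lemma gives \<open>w\<close> a positive slope at \<open>y\<close> in the direction of the
  centre \<open>z\<close>, whereas the gradient of \<open>w\<close> vanishes at the interior minimum \<open>y\<close>.\<close>

lemma no_interior_touching_ball:
  fixes z y :: "real^'n"
  assumes "open \<Omega>" "0 < c" "0 \<le> C" "0 \<le> Q"
    and ell: "\<And>x. x \<in> \<Omega> \<Longrightarrow> elliptic_bound c C (A x) (b x)"
    and j: "\<And>x. x \<in> \<Omega> \<Longrightarrow> jet2_at w W (Hw x) x"
    and nn: "\<And>x. x \<in> \<Omega> \<Longrightarrow> 0 \<le> w x"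
    and L: "\<forall>\<^sub>F x in nhds y. ndop (A x) (b x) (W x) (Hw x) \<le> Q * w x"
    and y: "y \<in> \<Omega>" "w y = 0" "dist z y = R" "0 < R"
    and pos: "\<And>x. x \<in> ball z R \<Longrightarrow> x \<in> \<Omega> \<Longrightarrow> 0 < w x"
  shows False
proof -
  have "\<forall>\<^sub>F x in nhds y. x \<in> \<Omega>" using assms(1) y(1) by (rule eventually_nhds_in_open)
  from eventually_conj[OF this L]
  obtain r0 where r0: "0 < r0" "\<And>x. x \<in> ball y r0 \<Longrightarrow> x \<in> \<Omega>"
    "\<And>x. x \<in> ball y r0 \<Longrightarrow> ndop (A x) (b x) (W x) (Hw x) \<le> Q * w x"
    by (auto simp: eventually_nhds_metric dist_commute)
  define \<rho> where "\<rho> = (\<lambda>x. R\<^sup>2 - (norm (x - z))\<^sup>2)"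
  define D where "D = 2 * C + 2 * (C * R)"
  have D: "C \<le> D" "0 \<le> D" using assms(3) y(4) by (auto simp: D_def add_increasing)
  have rho_pos: "0 < \<rho> x \<longleftrightarrow> x \<in> ball z R" for x
  proof -
    have "(norm (x - z))\<^sup>2 < R\<^sup>2 \<longleftrightarrow> norm (x - z) < R"
      using power_mono_iff[of R "norm (x - z)" 2] y(4) by (simp add: not_le[symmetric])
    then show ?thesis by (simp add: \<rho>_def dist_norm norm_minus_commute)
  qed
  have "\<exists>e>0. \<forall>\<^sub>F t in at_right 0. e * t \<le> w (y + t *\<^sub>R (z - y))"
  proof (rule hopf[where c = c and C = D and Q = Q and s = r0 and \<rho> = \<rho> and A = A and b = b and W = W and Hw = Hw
        and P = "\<lambda>x. - 2 *\<^sub>R (x - z)" and H = "\<lambda>x v. - 2 *\<^sub>R v"])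
    show "jet2_at \<rho> (\<lambda>x. - 2 *\<^sub>R (x - z)) (\<lambda>v. - 2 *\<^sub>R v) x" for x
      unfolding \<rho>_def by (rule jet2_at_sphere)
    show "\<rho> y = 0" using y(3) by (simp add: \<rho>_def dist_norm norm_minus_commute)
    fix x assume x: "x \<in> ball y r0"
    note e = ell[OF r0(2)[OF x]]
    show "elliptic_bound c D (A x) (b x)" using e D by (auto simp: elliptic_bound_def)
    show "\<bar>ndop (A x) (b x) (- 2 *\<^sub>R (x - z)) (\<lambda>v. - 2 *\<^sub>R v)\<bar> \<le> D" if "0 < \<rho> x"
    proof -
      have "\<bar>b x \<bullet> (x - z)\<bar> \<le> norm (b x) * norm (x - z)" by (rule Cauchy_Schwarz_ineq2)
      also have "\<dots> \<le> C * R"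
        using e that[unfolded rho_pos] assms(3)
        by (intro mult_mono) (auto simp: elliptic_bound_def dist_norm norm_minus_commute)
      finally have 1: "\<bar>b x \<bullet> (x - z)\<bar> \<le> C * R" .
      have "ndop (A x) (b x) (- 2 *\<^sub>R (x - z)) (\<lambda>v. - 2 *\<^sub>R v) = - 2 * (\<Sum>i\<in>UNIV. A x$i$i) - 2 * (b x \<bullet> (x - z))"
        by (simp add: ndop_def inner_axis sum_distrib_left sum_negf)
      moreover have "0 \<le> (\<Sum>i\<in>UNIV. A x$i$i)" "(\<Sum>i\<in>UNIV. A x$i$i) \<le> C"
        using elliptic_bound_trace_nonneg[OF e assms(2)] e by (auto simp: elliptic_bound_def)
      ultimately show ?thesis using 1 unfolding D_def by linarith
    qed
    show "0 \<le> w x" using nn[OF r0(2)[OF x]] .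
    show "jet2_at w W (Hw x) x" using j[OF r0(2)[OF x]] .
    show "ndop (A x) (b x) (W x) (Hw x) \<le> Q * w x" using r0(3)[OF x] .
    show "0 < \<rho> x \<Longrightarrow> 0 < w x" using pos r0(2)[OF x] by (simp add: rho_pos)
  next
    show "continuous_on (ball y r0 \<inter> {x. 0 \<le> \<rho> x}) w"
      using jet2_at_isCont[OF j] r0(2) by (intro continuous_at_imp_continuous_on) blast
    have "z \<noteq> y" using y by auto
    then show "0 < - 2 *\<^sub>R (y - z) \<bullet> (z - y)"
      by (metis (no_types, lifting) inner_gt_zero_iff inner_minus_left inner_scaleR_left minus_diff_eq mult_minus_left mult_pos_pos pos2 right_minus_eq scaleR_minus_left zero_less_numeral mult_minus_right)
  qed (use assms D r0 in auto)
  then obtain e where e: "0 < e" "\<forall>\<^sub>F t in at_right 0. e * t \<le> w (y + t *\<^sub>R (z - y))" by blast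
  have mi: "\<forall>\<^sub>F x in nhds y. w y \<le> w x"
    using eventually_nhds_in_open[OF assms(1) y(1)] by eventually_elim (simp add: y nn)
  have "W y = 0" by (rule jet2_local_min(1)[OF j[OF y(1)] mi])
  then have "((\<lambda>t. w (y + t *\<^sub>R (z - y))) has_real_derivative 0) (at 0)"
    using jet2_at_compose(1)[OF j[OF y(1)], of "z - y", THEN eventually_nhds_x_imp_x] by simp
  from DERIV_diff[OF this DERIV_cmult_Id[of "e"]]
  have "((\<lambda>t. w (y + t *\<^sub>R (z - y)) - e * t) has_real_derivative - e) (at 0)" by simp
  from has_real_derivative_neg_dec_right[OF this] e(1) y(2)
  obtain d where d: "d > 0" "\<And>t. 0 < t \<Longrightarrow> t < d \<Longrightarrow> w (y + t *\<^sub>R (z - y)) < e * t" by auto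
  have "\<forall>\<^sub>F t in at_right 0. t \<in> {0<..<d}" by (rule eventually_at_rightI[OF _ d(1)]) auto
  with e(2) have "\<forall>\<^sub>F t in at_right (0::real). False"
    by eventually_elim (use d(2) in fastforce)
  then show False by simp
qed

text \<open>If the zero set \<open>Z\<close> is not open, some zero \<open>y\<close> has points with \<open>w > 0\<close> arbitrarily close to it. The
  largest ball around such a point \<open>z\<close> that avoids \<open>Z\<close> lies in \<open>\<Omega>\<close> and touches \<open>Z\<close>, which is
  impossible by \<open>no_interior_touching_ball\<close>. So \<open>\<Omega>\<close> splits into two open sets. The differential
  inequality is required only near zeros of \<open>w\<close>, in the form needed for the weak principle.\<close>

lemma strong_minimum_principle:
  fixes \<Omega> :: "(real^'n) set"
  assumes "open \<Omega>" "connected \<Omega>" "0 < c" "0 \<le> C" "0 \<le> Q"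
    and ell: "\<And>x. x \<in> \<Omega> \<Longrightarrow> elliptic_bound c C (A x) (b x)"
    and j: "\<And>x. x \<in> \<Omega> \<Longrightarrow> jet2_at w W (Hw x) x"
    and nn: "\<And>x. x \<in> \<Omega> \<Longrightarrow> 0 \<le> w x"
    and L: "\<And>y. y \<in> \<Omega> \<Longrightarrow> w y = 0 \<Longrightarrow> \<forall>\<^sub>F x in nhds y. ndop (A x) (b x) (W x) (Hw x) \<le> Q * w x"
  shows "(\<forall>x\<in>\<Omega>. w x = 0) \<or> (\<forall>x\<in>\<Omega>. 0 < w x)"
proof -
  have cw: "continuous_on \<Omega> w" using jet2_at_isCont[OF j] by (intro continuous_at_imp_continuous_on) blast
  define Z where "Z = {x \<in> \<Omega>. w x = 0}"
  define N where "N = \<Omega> \<inter> w -` {0<..}"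
  have oN: "open N" unfolding N_def by (rule continuous_open_preimage[OF cw assms(1) open_greaterThan])
  have "open Z"
  proof (rule ccontr)
    assume "\<not> open Z"
    then obtain y where y: "y \<in> Z" "\<And>e. 0 < e \<Longrightarrow> \<not> ball y e \<subseteq> Z" by (auto simp: open_contains_ball)
    then obtain d where d: "0 < d" "cball y d \<subseteq> \<Omega>"
      using assms(1) unfolding Z_def open_contains_cball by blast
    obtain z where z: "dist y z < d / 2" "z \<notin> Z" using y(2)[of "d/2"] d(1) by (auto simp: subset_eq)
    define K where "K = cball y d - N"
    have K: "compact K" unfolding K_def by (rule compact_diff[OF compact_cball oN])
    have KZ: "K = cball y d \<inter> Z" using d(2) nn by (force simp: K_def N_def Z_def)
    have yK: "y \<in> K" using y(1) d by (simp add: KZ)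
    obtain x where x: "x \<in> K" "\<And>k. k \<in> K \<Longrightarrow> dist z x \<le> dist z k"
      using distance_attains_inf[OF compact_imp_closed[OF K], of z] yK by blast
    have xd: "dist z x < d / 2" using x(2)[OF yK] z(1) by (simp add: dist_commute)
    show False
    proof (rule no_interior_touching_ball[of \<Omega> c C Q A b w W Hw x z "dist z x"])
      show "x \<in> \<Omega>" "w x = 0" using x(1) by (auto simp: KZ Z_def)
      then show "\<forall>\<^sub>F x in nhds x. ndop (A x) (b x) (W x) (Hw x) \<le> Q * w x" by (rule L)
      show "0 < dist z x" using x(1) z(2) by (auto simp: KZ)
      fix k assume k: "k \<in> ball z (dist z x)" "k \<in> \<Omega>"
      have "dist y k \<le> dist y z + dist z k" by (rule dist_triangle)
      then have "k \<in> cball y d" using k(1) xd z(1) by simp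
      then have "k \<notin> Z" using x(2)[of k] k(1) by (auto simp: KZ)
      then show "0 < w k" using nn[OF k(2)] k(2) by (auto simp: Z_def)
    qed (use assms in auto)
  qed
  have cover: "\<Omega> \<subseteq> Z \<union> N" using nn by (force simp: Z_def N_def)
  have "Z \<inter> N \<inter> \<Omega> = {}" by (auto simp: Z_def N_def)
  from connectedD[OF assms(2) \<open>open Z\<close> oN this cover]
  have "Z \<inter> \<Omega> = {} \<or> N \<inter> \<Omega> = {}" .
  then show ?thesis using cover unfolding Z_def N_def by blast
qed

text \<open>Were the minimum of \<open>w\<close> negative, it would be attained in \<open>\<Omega>\<close>, and near any minimum point \<open>w\<close> would
  be negative. The strong principle for \<open>w\<close> minus its minimum makes \<open>w\<close> constant on \<open>\<Omega>\<close>, hence on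
  the closure, contrary to the boundary values.\<close>

lemma weak_minimum_principle:
  fixes \<Omega> :: "(real^'n) set"
  assumes "open \<Omega>" "connected \<Omega>" "bounded \<Omega>" "0 < c" "0 \<le> C"
    and ell: "\<And>x. x \<in> \<Omega> \<Longrightarrow> elliptic_bound c C (A x) (b x)"
    and j: "\<And>x. x \<in> \<Omega> \<Longrightarrow> jet2_at w W (Hw x) x"
    and cont: "continuous_on (closure \<Omega>) w"
    and bdry: "\<And>x. x \<in> frontier \<Omega> \<Longrightarrow> 0 \<le> w x"
    and L: "\<And>x. x \<in> \<Omega> \<Longrightarrow> w x < 0 \<Longrightarrow> ndop (A x) (b x) (W x) (Hw x) \<le> 0"
    and x: "x \<in> \<Omega>"
  shows "0 \<le> w x"
proof (rule ccontr)
  assume neg: "\<not> 0 \<le> w x"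
  have ne: "closure \<Omega> \<noteq> {}" using x by auto
  obtain y where y: "y \<in> closure \<Omega>" "\<And>z. z \<in> closure \<Omega> \<Longrightarrow> w y \<le> w z"
    using continuous_attains_inf[OF _ ne cont] \<open>bounded \<Omega>\<close> by (metis compact_closure)
  have wy: "w y < 0" using y(2)[of x] x neg closure_subset[of \<Omega>] by force
  then have y\<Omega>: "y \<in> \<Omega>" using bdry[of y] y(1) \<open>open \<Omega>\<close> by (fastforce simp: frontier_def interior_open)
  define v where "v = (\<lambda>x. 1 * w x + - w y)"
  have "(\<forall>x\<in>\<Omega>. v x = 0) \<or> (\<forall>x\<in>\<Omega>. 0 < v x)"
  proof (rule strong_minimum_principle[of \<Omega> c C 0 A b v "\<lambda>y. 1 *\<^sub>R W y" "\<lambda>x v. 1 *\<^sub>R Hw x v"])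
    show "jet2_at v (\<lambda>y. 1 *\<^sub>R W y) (\<lambda>v. 1 *\<^sub>R Hw x v) x" if "x \<in> \<Omega>" for x
      unfolding v_def by (rule jet2_at_affine(1)[OF j[OF that]])
    show "0 \<le> v x" if "x \<in> \<Omega>" for x using y(2)[of x] that closure_subset by (auto simp: v_def)
    fix z assume z: "z \<in> \<Omega>" "v z = 0"
    then have "w z < 0" using wy by (simp add: v_def)
    then have "\<forall>\<^sub>F x in nhds z. w x < 0"
      using jet2_at_isCont[OF j[OF z(1)]] tendsto_at_iff_tendsto_nhds[of w z]
      by (intro order_tendstoD(2)[of w "w z"]) (simp_all add: isCont_def)
    with eventually_nhds_in_open[OF \<open>open \<Omega>\<close> z(1)]
    show "\<forall>\<^sub>F x in nhds z. ndop (A x) (b x) (1 *\<^sub>R W x) (\<lambda>v. 1 *\<^sub>R Hw x v) \<le> 0 * v x"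
      by eventually_elim (simp add: L)
  qed (use assms in auto)
  then have const: "w x = w y" if "x \<in> \<Omega>" for x using that y\<Omega> by (auto simp: v_def)
  have "\<Omega> \<noteq> UNIV" using \<open>bounded \<Omega>\<close> not_bounded_UNIV by blast
  then obtain f where f: "f \<in> frontier \<Omega>" using frontier_not_empty[of \<Omega>] x by blast
  then have "f \<in> closure \<Omega>" by (simp add: frontier_def)
  then have "w f = w y"
    using continuous_constant_on_closure[OF cont const] by blast
  then show False using bdry[OF f] wy by simp
qed

section \<open>The elliptic operator in non-divergence form\<close>

lemma linear_functional_eq_inner:
  fixes l :: "real^'n \<Rightarrow> real"
  assumes "linear l"
  shows "l v = (\<chi> k. l (axis k 1)) \<bullet> v"
proof -
  have "v = (\<Sum>k\<in>UNIV. v$k *\<^sub>R axis k 1)"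
    by (metis (no_types, lifting) basis_expansion scalar_mult_eq_scaleR sum.cong)
  then have "l v = l (\<Sum>k\<in>UNIV. v$k *\<^sub>R axis k 1)" by (rule arg_cong)
  also have "\<dots> = (\<Sum>k\<in>UNIV. v$k * l (axis k 1))"
    by (simp add: linear_sum[OF assms] linear_cmul[OF assms])
  finally show ?thesis by (simp add: inner_vec_def mult.commute)
qed

lemma Ck_on_2_differentiable:
  assumes "Ck_on 2 S f" "open S" "x \<in> S" "b \<in> Basis"
  shows "f differentiable at x" "pd b f differentiable at x"
proof -
  have *: "\<And>bs. set bs \<subseteq> Basis \<and> length bs < 2 \<Longrightarrow> foldr pd bs f differentiable_on S"
    using assms(1) unfolding Ck_on_def by blast
  show "f differentiable at x" "pd b f differentiable at x"
    using *[of "[]"] *[of "[b]"] assms by (auto simp: differentiable_on_eq_differentiable_at)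
qed

lemma Ck_on_2_jet2_at:
  fixes f :: "real^'n \<Rightarrow> 'b::real_normed_vector"
  assumes f: "Ck_on 2 S f" "open S" "x \<in> S" and l: "bounded_linear l"
  shows "jet2_at (\<lambda>y. l (f y)) (\<lambda>y. \<chi> k. l (pd (axis k 1) f y))
     (\<lambda>v. \<chi> k. l (frechet_derivative (pd (axis k 1) f) (at x) v)) x"
proof -
  have "\<forall>\<^sub>F y in nhds x. y \<in> S" using f by (intro eventually_nhds_in_open)
  then have "\<forall>\<^sub>F y in nhds x. ((\<lambda>y. l (f y)) has_derivative (\<lambda>v. (\<chi> k. l (pd (axis k 1) f y)) \<bullet> v)) (at y)"
  proof eventually_elim
    case (elim y)
    have "(f has_derivative frechet_derivative f (at y)) (at y)"
      using Ck_on_2_differentiable(1)[OF f(1,2) elim, of "axis undefined 1"] frechet_derivative_works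
      by auto
    then have d: "((\<lambda>y. l (f y)) has_derivative (\<lambda>v. l (frechet_derivative f (at y) v))) (at y)"
      by (rule bounded_linear.has_derivative[OF l])
    then have "linear (\<lambda>v. l (frechet_derivative f (at y) v))" by (rule has_derivative_linear)
    then have eq: "(\<lambda>v. l (frechet_derivative f (at y) v)) = (\<lambda>v. (\<chi> k. l (pd (axis k 1) f y)) \<bullet> v)"
      unfolding pd_def by (rule ext[OF linear_functional_eq_inner])
    show ?case using d unfolding eq .
  qed
  moreover have "((\<lambda>y. \<chi> k. l (pd (axis k 1) f y)) has_derivative
     (\<lambda>v. \<chi> k. l (frechet_derivative (pd (axis k 1) f) (at x) v))) (at x)"
  proof (subst has_derivative_componentwise_within, rule ballI)
    fix i :: "real^'n" assume "i \<in> Basis"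
    then obtain k where k: "i = axis k 1" by (auto simp: Basis_vec_def)
    have "(pd (axis k 1) f has_derivative frechet_derivative (pd (axis k 1) f) (at x)) (at x)"
      using Ck_on_2_differentiable(2)[OF f, of "axis k 1"] frechet_derivative_works by auto
    then show "((\<lambda>y. (\<chi> k. l (pd (axis k 1) f y)) \<bullet> i) has_derivative
       (\<lambda>v. (\<chi> k. l (frechet_derivative (pd (axis k 1) f) (at x) v)) \<bullet> i)) (at x)"
      by (simp add: k inner_axis bounded_linear.has_derivative[OF l])
  qed
  ultimately show ?thesis by (simp add: jet2_at_def)
qed

text \<open>This class is closed under sums, products and negative powers of functions bounded below, so that
  the drift can be bounded without computing the derivative of a determinant.\<close>

definition C1_bounded_on :: "(real^'n) set \<Rightarrow> (real^'n \<Rightarrow> real) \<Rightarrow> bool" where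
  "C1_bounded_on S f \<longleftrightarrow>
     (\<exists>B. \<forall>x\<in>S. \<bar>f x\<bar> \<le> B \<and> (\<exists>p. norm p \<le> B \<and> (f has_derivative (\<lambda>v. p \<bullet> v)) (at x)))"

lemma C1_bounded_onE:
  assumes "C1_bounded_on S f"
  obtains B p where "0 \<le> B" "\<And>x. x \<in> S \<Longrightarrow> \<bar>f x\<bar> \<le> B" "\<And>x. x \<in> S \<Longrightarrow> norm (p x) \<le> B"
    "\<And>x. x \<in> S \<Longrightarrow> (f has_derivative (\<lambda>v. p x \<bullet> v)) (at x)"
proof -
  obtain B where B: "\<forall>x\<in>S. \<bar>f x\<bar> \<le> B \<and> (\<exists>p. norm p \<le> B \<and> (f has_derivative (\<lambda>v. p \<bullet> v)) (at x))"
    using assms unfolding C1_bounded_on_def by blast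
  then obtain p where "\<forall>x\<in>S. \<bar>f x\<bar> \<le> B \<and> norm (p x) \<le> B \<and> (f has_derivative (\<lambda>v. p x \<bullet> v)) (at x)"
    by metis
  then show ?thesis using that[of "max 0 B" p] by fastforce
qed

lemma C1_bounded_on_imp_bounded:
  assumes "C1_bounded_on S f"
  shows "\<exists>B\<ge>0. \<forall>x\<in>S. \<bar>f x\<bar> \<le> B"
  by (rule C1_bounded_onE[OF assms]) blast

lemma C1_bounded_onI:
  assumes "\<And>x. x \<in> S \<Longrightarrow> \<bar>f x\<bar> \<le> B" "\<And>x. x \<in> S \<Longrightarrow> norm (p x) \<le> D"
    "\<And>x. x \<in> S \<Longrightarrow> (f has_derivative (\<lambda>v. p x \<bullet> v)) (at x)"
  shows "C1_bounded_on S f"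
  unfolding C1_bounded_on_def
proof (intro exI[of _ "max B D"] ballI conjI)
  fix x assume x: "x \<in> S"
  show "\<bar>f x\<bar> \<le> max B D" using assms(1)[OF x] by simp
  show "\<exists>q. norm q \<le> max B D \<and> (f has_derivative (\<lambda>v. q \<bullet> v)) (at x)"
    using assms(2,3)[OF x] by (intro exI[of _ "p x"]) simp
qed

lemma C1_bounded_on_const: "C1_bounded_on S (\<lambda>x. k)"
  by (rule C1_bounded_onI[where p = "\<lambda>x. 0" and B = "\<bar>k\<bar>" and D = 0]) (auto intro!: derivative_eq_intros)

lemma C1_bounded_on_add:
  assumes "C1_bounded_on S f" "C1_bounded_on S g"
  shows "C1_bounded_on S (\<lambda>x. f x + g x)"
proof -
  obtain B p where f: "0 \<le> B" "\<And>x. x \<in> S \<Longrightarrow> \<bar>f x\<bar> \<le> B" "\<And>x. x \<in> S \<Longrightarrow> norm (p x) \<le> B"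
    "\<And>x. x \<in> S \<Longrightarrow> (f has_derivative (\<lambda>v. p x \<bullet> v)) (at x)" using C1_bounded_onE[OF assms(1)] by blast
  obtain D q where g: "0 \<le> D" "\<And>x. x \<in> S \<Longrightarrow> \<bar>g x\<bar> \<le> D" "\<And>x. x \<in> S \<Longrightarrow> norm (q x) \<le> D"
    "\<And>x. x \<in> S \<Longrightarrow> (g has_derivative (\<lambda>v. q x \<bullet> v)) (at x)" using C1_bounded_onE[OF assms(2)] by blast
  show ?thesis
  proof (rule C1_bounded_onI[where p = "\<lambda>x. p x + q x" and B = "B + D" and D = "B + D"])
    fix x assume x: "x \<in> S"
    show "\<bar>f x + g x\<bar> \<le> B + D" using f(2)[OF x] g(2)[OF x] by linarith
    show "norm (p x + q x) \<le> B + D" using f(3)[OF x] g(3)[OF x] by (rule norm_triangle_mono)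
    show "((\<lambda>x. f x + g x) has_derivative (\<lambda>v. (p x + q x) \<bullet> v)) (at x)"
      using has_derivative_add[OF f(4)[OF x] g(4)[OF x]] by (simp add: inner_add_left)
  qed
qed

lemma C1_bounded_on_mult:
  assumes "C1_bounded_on S f" "C1_bounded_on S g"
  shows "C1_bounded_on S (\<lambda>x. f x * g x)"
proof -
  obtain B p where f: "0 \<le> B" "\<And>x. x \<in> S \<Longrightarrow> \<bar>f x\<bar> \<le> B" "\<And>x. x \<in> S \<Longrightarrow> norm (p x) \<le> B"
    "\<And>x. x \<in> S \<Longrightarrow> (f has_derivative (\<lambda>v. p x \<bullet> v)) (at x)" using C1_bounded_onE[OF assms(1)] by blast
  obtain D q where g: "0 \<le> D" "\<And>x. x \<in> S \<Longrightarrow> \<bar>g x\<bar> \<le> D" "\<And>x. x \<in> S \<Longrightarrow> norm (q x) \<le> D"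
    "\<And>x. x \<in> S \<Longrightarrow> (g has_derivative (\<lambda>v. q x \<bullet> v)) (at x)" using C1_bounded_onE[OF assms(2)] by blast
  show ?thesis
  proof (rule C1_bounded_onI[where p = "\<lambda>x. f x *\<^sub>R q x + g x *\<^sub>R p x" and B = "B * D" and D = "B * D + D * B"])
    fix x assume x: "x \<in> S"
    show "\<bar>f x * g x\<bar> \<le> B * D" unfolding abs_mult using f g x by (intro mult_mono) auto
    show "norm (f x *\<^sub>R q x + g x *\<^sub>R p x) \<le> B * D + D * B"
      by (rule norm_triangle_mono) (use f g x in \<open>auto intro!: mult_mono\<close>)
    show "((\<lambda>x. f x * g x) has_derivative (\<lambda>v. (f x *\<^sub>R q x + g x *\<^sub>R p x) \<bullet> v)) (at x)"
      using has_derivative_mult[OF f(4)[OF x] g(4)[OF x]] by (simp add: inner_add_left mult.commute)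
  qed
qed

lemma C1_bounded_on_sum:
  "finite I \<Longrightarrow> (\<And>i. i \<in> I \<Longrightarrow> C1_bounded_on S (f i)) \<Longrightarrow> C1_bounded_on S (\<lambda>x. \<Sum>i\<in>I. f i x)"
  by (induction I rule: finite_induct) (auto intro: C1_bounded_on_const C1_bounded_on_add)

lemma C1_bounded_on_prod:
  "finite I \<Longrightarrow> (\<And>i. i \<in> I \<Longrightarrow> C1_bounded_on S (f i)) \<Longrightarrow> C1_bounded_on S (\<lambda>x. \<Prod>i\<in>I. f i x)"
  by (induction I rule: finite_induct) (auto intro: C1_bounded_on_const C1_bounded_on_mult)

lemma C1_bounded_on_powr:
  assumes "C1_bounded_on S f" "0 < m" "\<And>x. x \<in> S \<Longrightarrow> m \<le> f x" "s < 0"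
  shows "C1_bounded_on S (\<lambda>x. f x powr s)"
proof -
  obtain B p where f: "0 \<le> B" "\<And>x. x \<in> S \<Longrightarrow> \<bar>f x\<bar> \<le> B" "\<And>x. x \<in> S \<Longrightarrow> norm (p x) \<le> B"
    "\<And>x. x \<in> S \<Longrightarrow> (f has_derivative (\<lambda>v. p x \<bullet> v)) (at x)" using C1_bounded_onE[OF assms(1)] by blast
  show ?thesis
  proof (rule C1_bounded_onI[where p = "\<lambda>x. (s * f x powr (s - 1)) *\<^sub>R p x" and B = "m powr s" and D = "\<bar>s\<bar> * m powr (s - 1) * B"])
    fix x assume x: "x \<in> S"
    have fx: "0 < f x" using assms(2,3) x by fastforce
    show "\<bar>f x powr s\<bar> \<le> m powr s"
      using powr_mono2'[of s m "f x"] assms(2-4) x by simp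
    have "f x powr (s - 1) \<le> m powr (s - 1)"
      using powr_mono2'[of "s - 1" m "f x"] assms(2-4) x by simp
    then show "norm ((s * f x powr (s - 1)) *\<^sub>R p x) \<le> \<bar>s\<bar> * m powr (s - 1) * B"
      using f(3)[OF x] by (auto simp: abs_mult intro!: mult_mono)
    have "((\<lambda>x. f x powr s) has_derivative (\<lambda>h. f x powr s * (0 * ln (f x) + (p x \<bullet> h) * s / f x))) (at x)"
      by (rule has_derivative_powr[OF f(4)[OF x] has_derivative_const fx]) simp
    then show "((\<lambda>x. f x powr s) has_derivative (\<lambda>v. ((s * f x powr (s - 1)) *\<^sub>R p x) \<bullet> v)) (at x)"
      using fx by (simp add: powr_diff mult_ac)
  qed
qed

lemma C1_bounded_on_pd:
  assumes "C1_bounded_on S f"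
  obtains B where "0 \<le> B" "\<And>x k. x \<in> S \<Longrightarrow> \<bar>pd (axis k 1) f x\<bar> \<le> B"
proof -
  obtain B p where f: "0 \<le> B" "\<And>x. x \<in> S \<Longrightarrow> \<bar>f x\<bar> \<le> B" "\<And>x. x \<in> S \<Longrightarrow> norm (p x) \<le> B"
    "\<And>x. x \<in> S \<Longrightarrow> (f has_derivative (\<lambda>v. p x \<bullet> v)) (at x)" using C1_bounded_onE[OF assms(1)] by blast
  have "\<bar>pd (axis k 1) f x\<bar> \<le> B" if "x \<in> S" for x k
  proof -
    have "pd (axis k 1) f x = p x $ k"
      unfolding pd_def frechet_derivative_at[OF f(4)[OF that], symmetric] by (simp add: inner_axis)
    then show ?thesis using component_le_norm_cart[of "p x" k] f(3)[OF that] by linarith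
  qed
  then show ?thesis by (rule that[OF f(1)])
qed

lemma C1_bounded_on_differentiable:
  "C1_bounded_on S f \<Longrightarrow> x \<in> S \<Longrightarrow> f differentiable at x"
  unfolding C1_bounded_on_def differentiable_def by blast

lemma C1_bounded_on_cong:
  assumes "C1_bounded_on S f" "\<And>x. x \<in> S \<Longrightarrow> f x = g x" "open S"
  shows "C1_bounded_on S g"
proof -
  obtain B p where f: "0 \<le> B" "\<And>x. x \<in> S \<Longrightarrow> \<bar>f x\<bar> \<le> B" "\<And>x. x \<in> S \<Longrightarrow> norm (p x) \<le> B"
    "\<And>x. x \<in> S \<Longrightarrow> (f has_derivative (\<lambda>v. p x \<bullet> v)) (at x)" using C1_bounded_onE[OF assms(1)] by blast
  show ?thesis
  proof (rule C1_bounded_onI[where p = p and B = B and D = B])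
    fix x assume x: "x \<in> S"
    show "\<bar>g x\<bar> \<le> B" using f(2)[OF x] assms(2)[OF x] by simp
    show "norm (p x) \<le> B" by (rule f(3)[OF x])
    show "(g has_derivative (\<lambda>v. p x \<bullet> v)) (at x)"
      by (rule has_derivative_transform_within_open[OF f(4)[OF x] assms(3) x assms(2)])
  qed
qed

lemma Ck_closure_2_bounded_linear:
  fixes f :: "real^'n \<Rightarrow> 'b::real_normed_vector"
  assumes "Ck_closure 2 \<Omega> f" "open \<Omega>" "bounded \<Omega>" and l: "bounded_linear l"
  shows "C1_bounded_on \<Omega> (\<lambda>x. l (f x))"
proof -
  have K: "compact (closure \<Omega>)" using \<open>bounded \<Omega>\<close> by simp
  have bd: "\<exists>B. \<forall>x\<in>\<Omega>. \<bar>l (g x)\<bar> \<le> B" if "continuous_on (closure \<Omega>) h" "\<forall>x\<in>\<Omega>. h x = g x" for h g :: "real^'n \<Rightarrow> 'b"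
  proof -
    have "continuous_on (closure \<Omega>) (\<lambda>x. l (h x))" by (rule bounded_linear.continuous_on[OF l that(1)])
    then have "bounded ((\<lambda>x. l (h x)) ` closure \<Omega>)" using K compact_continuous_image compact_imp_bounded by blast
    then obtain B where "\<And>x. x \<in> closure \<Omega> \<Longrightarrow> \<bar>l (h x)\<bar> \<le> B" by (auto simp: bounded_iff)
    then have "\<forall>x\<in>\<Omega>. \<bar>l (g x)\<bar> \<le> B" using that(2) closure_subset[of \<Omega>] by fastforce
    then show ?thesis ..
  qed
  have ext: "\<exists>h. continuous_on (closure \<Omega>) h \<and> (\<forall>x\<in>\<Omega>. h x = foldr pd bs f x)"
    if "set bs \<subseteq> Basis" "length bs \<le> 2" for bs
    using assms(1) that unfolding Ck_closure_def by blast
  have "\<exists>B. \<forall>x\<in>\<Omega>. \<bar>l (f x)\<bar> \<le> B"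
    using bd[of _ f] ext[of "[]"] by auto
  then obtain B0 where B0: "\<And>x. x \<in> \<Omega> \<Longrightarrow> \<bar>l (f x)\<bar> \<le> B0" by blast
  have "\<exists>B. \<forall>x\<in>\<Omega>. \<bar>l (pd (axis k 1) f x)\<bar> \<le> B" for k
    using bd[of _ "pd (axis k 1) f"] ext[of "[axis k 1]"] by auto
  then have "\<exists>B. \<forall>k. \<forall>x\<in>\<Omega>. \<bar>l (pd (axis k 1) f x)\<bar> \<le> B k" by (intro choice allI)
  then obtain B where B: "\<And>k x. x \<in> \<Omega> \<Longrightarrow> \<bar>l (pd (axis k 1) f x)\<bar> \<le> B k" by blast
  show ?thesis
  proof (rule C1_bounded_onI[where B = B0 and D = "\<Sum>k\<in>UNIV. B k" and p = "\<lambda>y. \<chi> k. l (pd (axis k 1) f y)"])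
    fix x assume x: "x \<in> \<Omega>"
    show "\<bar>l (f x)\<bar> \<le> B0" by (rule B0[OF x])
    show "norm (\<chi> k. l (pd (axis k 1) f x)) \<le> (\<Sum>k\<in>UNIV. B k)"
      by (rule order_trans[OF norm_le_l1_cart]) (use B[OF x] in \<open>auto intro!: sum_mono\<close>)
    show "((\<lambda>x. l (f x)) has_derivative (\<lambda>v. (\<chi> k. l (pd (axis k 1) f x)) \<bullet> v)) (at x)"
      using assms(1) by (intro jet2_at_has_derivative[OF Ck_on_2_jet2_at[OF _ assms(2) x l]]) (simp add: Ck_closure_def)
  qed
qed

lemma quadratic_form_eq:
  fixes A :: "real^'n^'n"
  shows "v \<bullet> (A *v v) = (\<Sum>i\<in>UNIV. \<Sum>j\<in>UNIV. A$i$j * v$i * v$j)"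
  by (simp add: inner_vec_def matrix_vector_mult_def sum_distrib_left mult_ac)

lemma elliptic_det_nonzero:
  fixes A :: "real^'n^'n"
  assumes "0 < c" "\<And>v. c * (norm v)\<^sup>2 \<le> v \<bullet> (A *v v)"
  shows "det A \<noteq> 0"
proof -
  have "v = 0" if "A *v v = 0" for v
    using assms(2)[of v] assms(1) that by (auto simp: mult_le_0_iff)
  then have "invertible A"
    using matrix_left_invertible_ker invertible_left_inverse by blast
  then show ?thesis by (simp add: invertible_det_nz)
qed

text \<open>The first-order coefficient that the product rule produces from the divergence form.\<close>

definition drift :: "(real^'n \<Rightarrow> real^'n^'n) \<Rightarrow> real^'n \<Rightarrow> real^'n" where
  "drift a x = (\<chi> k. \<bar>det (a x)\<bar> powr (1/2) *
     (\<Sum>i\<in>UNIV. pd (axis i 1) (\<lambda>y. \<bar>det (a y)\<bar> powr (-1/2) * a y $ i $ k) x))"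

definition grad :: "(real^'n \<Rightarrow> real) \<Rightarrow> real^'n \<Rightarrow> real^'n" where
  "grad u x = (\<chi> k. pd (axis k 1) u x)"

definition hess :: "(real^'n \<Rightarrow> real) \<Rightarrow> real^'n \<Rightarrow> real^'n \<Rightarrow> real^'n" where
  "hess u x v = (\<chi> k. frechet_derivative (pd (axis k 1) u) (at x) v)"

context
  fixes \<Omega> :: "(real^'n) set" and a :: "real^'n \<Rightarrow> real^'n^'n" and c :: real
  assumes dom: "open \<Omega>" "bounded \<Omega>"
    and areg: "Ck_closure 2 \<Omega> a"
    and asym: "\<And>x i j. x \<in> closure \<Omega> \<Longrightarrow> a x $ i $ j = a x $ j $ i"
    and c: "0 < c"
    and aell: "\<And>x v. x \<in> closure \<Omega> \<Longrightarrow> c * (norm v)\<^sup>2 \<le> v \<bullet> (a x *v v)"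
begin

lemma entry_C1_bounded: "C1_bounded_on \<Omega> (\<lambda>x. a x $ i $ j)"
  using Ck_closure_2_bounded_linear[OF areg dom, of "\<lambda>M. M $ i $ j"]
  by (simp add: bounded_linear_compose[OF bounded_linear_vec_nth bounded_linear_vec_nth])

lemma det_C1_bounded: "C1_bounded_on \<Omega> (\<lambda>x. det (a x))"
  unfolding det_def
  by (intro C1_bounded_on_sum C1_bounded_on_mult C1_bounded_on_const C1_bounded_on_prod entry_C1_bounded) auto

lemma det_nonzero: "x \<in> closure \<Omega> \<Longrightarrow> det (a x) \<noteq> 0"
  using elliptic_det_nonzero[OF c aell] .

lemma det_square_lower_bound: "\<exists>m>0. \<forall>x\<in>\<Omega>. m \<le> (det (a x))\<^sup>2"
proof (cases "\<Omega> = {}")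
  case False
  have "continuous_on (closure \<Omega>) a" using areg by (simp add: Ck_closure_def)
  then have "continuous_on (closure \<Omega>) (\<lambda>x. (det (a x))\<^sup>2)"
    unfolding det_def by (intro continuous_intros)
  moreover have "compact (closure \<Omega>)" "closure \<Omega> \<noteq> {}" using dom False by auto
  ultimately obtain y where "y \<in> closure \<Omega>" "\<And>x. x \<in> closure \<Omega> \<Longrightarrow> (det (a y))\<^sup>2 \<le> (det (a x))\<^sup>2"
    using continuous_attains_inf[of "closure \<Omega>" "\<lambda>x. (det (a x))\<^sup>2"] by auto
  then show ?thesis using det_nonzero[of y] closure_subset[of \<Omega>]
    by (intro exI[of _ "(det (a y))\<^sup>2"]) auto
qed (auto intro: exI[of _ 1])

text \<open>The absolute value is removed by writing \<open>\<bar>D\<bar> powr (-1/2)\<close> as \<open>(D * D) powr (-1/4)\<close>.\<close>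

lemma weight_C1_bounded: "C1_bounded_on \<Omega> (\<lambda>x. \<bar>det (a x)\<bar> powr (-1/2) * a x $ i $ k)"
proof (rule C1_bounded_on_mult[OF _ entry_C1_bounded])
  obtain m where m: "m > 0" "\<And>x. x \<in> \<Omega> \<Longrightarrow> m \<le> (det (a x))\<^sup>2" using det_square_lower_bound by blast
  have "C1_bounded_on \<Omega> (\<lambda>x. (det (a x) * det (a x)) powr (-1/4))"
    by (rule C1_bounded_on_powr[OF C1_bounded_on_mult[OF det_C1_bounded det_C1_bounded] m(1)])
      (use m in \<open>auto simp: power2_eq_square\<close>)
  moreover have "(det (a x) * det (a x)) powr (-1/4) = \<bar>det (a x)\<bar> powr (-1/2)" if "x \<in> \<Omega>" for x
  proof -
    have eq: "det (a x) * det (a x) = \<bar>det (a x)\<bar> powr 2" using det_nonzero[of x] that closure_subset[of \<Omega>]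
      by (simp add: power2_eq_square powr_numeral)
    show ?thesis unfolding eq powr_powr by simp
  qed
  ultimately show "C1_bounded_on \<Omega> (\<lambda>x. \<bar>det (a x)\<bar> powr (-1/2))"
    by (rule C1_bounded_on_cong[OF _ _ dom(1)])
qed

lemma elliptic_bound_coefficients:
  "\<exists>C\<ge>0. \<forall>x\<in>\<Omega>. elliptic_bound c C (a x) (drift a x)"
proof -
  obtain D where D: "0 \<le> D" "\<And>x. x \<in> \<Omega> \<Longrightarrow> \<bar>det (a x)\<bar> \<le> D"
    using C1_bounded_on_imp_bounded[OF det_C1_bounded] by blast
  define G where "G i k = pd (axis i 1) (\<lambda>y. \<bar>det (a y)\<bar> powr (-1/2) * a y $ i $ k)" for i k
  have "\<exists>B\<ge>0. \<forall>x\<in>\<Omega>. \<bar>G i k x\<bar> \<le> B" for i k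
    unfolding G_def by (rule C1_bounded_on_pd[OF weight_C1_bounded]) blast
  then obtain B where B: "\<And>i k. 0 \<le> B i k" "\<And>i k x. x \<in> \<Omega> \<Longrightarrow> \<bar>G i k x\<bar> \<le> B i k"
    by metis
  have "\<exists>B\<ge>0. \<forall>x\<in>\<Omega>. \<bar>a x $ i $ i\<bar> \<le> B" for i
    by (rule C1_bounded_on_imp_bounded[OF entry_C1_bounded])
  then obtain T where T: "\<And>i. 0 \<le> T i" "\<And>i x. x \<in> \<Omega> \<Longrightarrow> \<bar>a x $ i $ i\<bar> \<le> T i" by metis
  define M where "M = (\<Sum>k\<in>UNIV. D powr (1/2) * (\<Sum>i\<in>UNIV. B i k))"
  have M: "0 \<le> M" unfolding M_def by (intro sum_nonneg mult_nonneg_nonneg B) auto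
  have ST: "0 \<le> (\<Sum>i\<in>UNIV. T i)" by (intro sum_nonneg T)
  show ?thesis
  proof (intro exI[of _ "M + (\<Sum>i\<in>UNIV. T i)"] conjI ballI)
    show "0 \<le> M + (\<Sum>i\<in>UNIV. T i)" using M ST by simp
    fix x assume x: "x \<in> \<Omega>"
    then have xc: "x \<in> closure \<Omega>" using closure_subset by blast
    have "norm (drift a x) \<le> M"
      unfolding M_def
    proof (rule order_trans[OF norm_le_l1_cart], rule sum_mono)
      fix k
      have "\<bar>\<Sum>i\<in>UNIV. G i k x\<bar> \<le> (\<Sum>i\<in>UNIV. B i k)"
        by (rule order_trans[OF sum_abs]) (intro sum_mono B x)
      moreover have "\<bar>det (a x)\<bar> powr (1/2) \<le> D powr (1/2)" using D(2)[OF x] by (intro powr_mono2) auto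
      moreover have "drift a x $ k = \<bar>det (a x)\<bar> powr (1/2) * (\<Sum>i\<in>UNIV. G i k x)"
        by (simp add: drift_def G_def)
      ultimately show "\<bar>drift a x $ k\<bar> \<le> D powr (1/2) * (\<Sum>i\<in>UNIV. B i k)"
        by (simp only: abs_mult abs_of_nonneg[OF powr_ge_zero]) (rule mult_mono, auto)
    qed
    moreover have "(\<Sum>i\<in>UNIV. a x $ i $ i) \<le> (\<Sum>i\<in>UNIV. T i)"
      by (rule sum_mono) (rule abs_le_D1[OF T(2)[OF x]])
    ultimately show "elliptic_bound c (M + (\<Sum>i\<in>UNIV. T i)) (a x) (drift a x)"
      unfolding elliptic_bound_def using M ST
      by (intro conjI allI asym[OF xc] aell[OF xc]) linarith+
  qed
qed

text \<open>The outer factor \<open>s\<close> cancels the density \<open>J\<close> in front of the second derivatives of \<open>u\<close>.\<close>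

lemma elliptic_op_eq_ndop:
  assumes u: "Ck_on 2 \<Omega> u" and x: "x \<in> \<Omega>"
  shows "elliptic_op a u x = - ndop (a x) (drift a x) (grad u x) (hess u x)"
proof -
  define J where "J = (\<lambda>y. \<bar>det (a y)\<bar> powr (-1/2))"
  define s where "s = \<bar>det (a x)\<bar> powr (1/2)"
  have sJ: "s * J x = 1"
    using det_nonzero[of x] x closure_subset[of \<Omega>] by (auto simp: s_def J_def powr_add[symmetric])
  have prod: "pd (axis i 1) (\<lambda>y. J y * a y $ i $ k * pd (axis k 1) u y) x =
     J x * a x $ i $ k * hess u x (axis i 1) $ k + pd (axis i 1) (\<lambda>y. J y * a y $ i $ k) x * grad u x $ k" for i k
  proof -
    have 1: "((\<lambda>y. J y * a y $ i $ k) has_derivative frechet_derivative (\<lambda>y. J y * a y $ i $ k) (at x)) (at x)"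
      using C1_bounded_on_differentiable[OF weight_C1_bounded x, of i k] frechet_derivative_works by (auto simp: J_def)
    have 2: "(pd (axis k 1) u has_derivative frechet_derivative (pd (axis k 1) u) (at x)) (at x)"
      using Ck_on_2_differentiable(2)[OF u dom(1) x, of "axis k 1"] frechet_derivative_works by auto
    show ?thesis
      unfolding pd_def[of _ "\<lambda>y. J y * a y $ i $ k * pd (axis k 1) u y"] frechet_derivative_at[OF has_derivative_mult[OF 1 2], symmetric]
      by (simp add: hess_def grad_def pd_def)
  qed
  define W where "W i k = pd (axis i 1) (\<lambda>y. J y * a y $ i $ k) x" for i k
  have drift: "drift a x $ k = s * (\<Sum>i\<in>UNIV. W i k)" for k
    by (simp add: drift_def s_def W_def J_def)
  have "elliptic_op a u x = - (s * (\<Sum>i\<in>UNIV. \<Sum>k\<in>UNIV.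
      pd (axis i 1) (\<lambda>y. J y * a y $ i $ k * pd (axis k 1) u y) x))"
    unfolding elliptic_op_def s_def J_def by (rule refl)
  also have "\<dots> = - (s * (\<Sum>i\<in>UNIV. \<Sum>k\<in>UNIV.
      J x * a x $ i $ k * hess u x (axis i 1) $ k + W i k * grad u x $ k))"
    by (simp only: prod W_def)
  also have "s * (\<Sum>i\<in>UNIV. \<Sum>k\<in>UNIV.
      J x * a x $ i $ k * hess u x (axis i 1) $ k + W i k * grad u x $ k) =
    (\<Sum>i\<in>UNIV. \<Sum>k\<in>UNIV. s * J x * (a x $ i $ k * hess u x (axis i 1) $ k)) +
    (\<Sum>i\<in>UNIV. \<Sum>k\<in>UNIV. s * W i k * grad u x $ k)"
    by (simp only: sum_distrib_left sum.distrib distrib_left mult.assoc)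
  also have "(\<Sum>i\<in>UNIV. \<Sum>k\<in>UNIV. s * W i k * grad u x $ k) = drift a x \<bullet> grad u x"
    by (subst sum.swap) (simp add: inner_vec_def drift sum_distrib_left sum_distrib_right)
  finally show ?thesis unfolding sJ by (simp add: ndop_def inner_vec_def)
qed

end

lemma Ck_on_2_jet2_grad:
  assumes "Ck_on 2 S u" "open S" "x \<in> S"
  shows "jet2_at u (grad u) (hess u x) x"
  using Ck_on_2_jet2_at[OF assms bounded_linear_ident] by (simp add: grad_def[abs_def] hess_def[abs_def])

section \<open>Boundary charts and the outward normal\<close>

text \<open>The distinguished coordinate \<open>\<rho>\<close> of the chart is a defining function of \<open>\<Omega>\<close>. As \<open>\<phi>\<close> inverts
  \<open>\<psi>\<close>, the derivative of \<open>\<psi>\<close> is invertible; therefore the gradient of \<open>\<rho>\<close> does not vanish, and \<open>\<phi>\<close>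
  maps the lines of the hyperplane \<open>{z. z \<bullet> b = 0}\<close> to boundary curves that realise every vector
  orthogonal to that gradient as a velocity.\<close>

lemma chart_defining_function:
  fixes \<Omega> :: "(real^'n) set"
  assumes ch: "boundary_chart 2 \<alpha> \<Omega> x0 U \<psi> \<phi> b" and x0: "x0 \<in> frontier \<Omega>"
  defines "\<rho> \<equiv> \<lambda>x. \<psi> x \<bullet> b" and "P \<equiv> \<lambda>y. \<chi> k. pd (axis k 1) \<psi> y \<bullet> b"
    and "H \<equiv> \<lambda>x v. \<chi> k. frechet_derivative (pd (axis k 1) \<psi>) (at x) v \<bullet> b"
  shows "\<And>x. x \<in> U \<Longrightarrow> jet2_at \<rho> P (H x) x" and "\<rho> x0 = 0"
    and "\<And>x. x \<in> U \<Longrightarrow> 0 < \<rho> x \<longleftrightarrow> x \<in> \<Omega>" and "\<And>x. x \<in> U \<Longrightarrow> \<rho> x = 0 \<longleftrightarrow> x \<in> frontier \<Omega>"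
    and "P x0 \<noteq> 0"
    and "\<And>v. P x0 \<bullet> v = 0 \<Longrightarrow> \<exists>\<gamma>. \<gamma> 0 = x0 \<and> (\<forall>\<^sub>F t in nhds 0. \<gamma> t \<in> frontier \<Omega>) \<and> (\<gamma> has_vector_derivative v) (at 0)"
    and "\<And>i. isCont (\<lambda>x. H x (axis i 1)) x0"
proof -
  have U: "open U" "x0 \<in> U" and V: "open (\<psi> ` U)" and inv: "\<And>y. y \<in> U \<Longrightarrow> \<phi> (\<psi> y) = y"
    and \<psi>: "Ck_on 2 U \<psi>" and \<phi>: "Ck_on 2 (\<psi> ` U) \<phi>" and b: "b \<in> Basis"
    and In: "\<psi> ` (U \<inter> \<Omega>) = {z \<in> \<psi> ` U. z \<bullet> b > 0}"
    and Fr: "\<psi> ` (U \<inter> frontier \<Omega>) = {z \<in> \<psi> ` U. z \<bullet> b = 0}"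
    using ch by (auto simp: boundary_chart_def Ck_holder_on_def)
  have inj: "inj_on \<psi> U" using inv by (metis inj_onI)
  show jet: "jet2_at \<rho> P (H x) x" if "x \<in> U" for x
    unfolding \<rho>_def P_def H_def
    by (rule Ck_on_2_jet2_at[OF \<psi> U(1) that bounded_linear_inner_left])
  show io: "0 < \<rho> x \<longleftrightarrow> x \<in> \<Omega>" if "x \<in> U" for x
  proof -
    have "\<psi> x \<in> \<psi> ` (U \<inter> \<Omega>) \<longleftrightarrow> x \<in> \<Omega>" using inj that by (auto dest: inj_onD)
    then show ?thesis using that unfolding In by (simp add: \<rho>_def)
  qed
  show fr: "\<rho> x = 0 \<longleftrightarrow> x \<in> frontier \<Omega>" if "x \<in> U" for x
  proof -
    have "\<psi> x \<in> \<psi> ` (U \<inter> frontier \<Omega>) \<longleftrightarrow> x \<in> frontier \<Omega>" using inj that by (auto dest: inj_onD)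
    then show ?thesis using that unfolding Fr by (simp add: \<rho>_def)
  qed
  show \<rho>0: "\<rho> x0 = 0" using fr[OF U(2)] x0 by simp
  define D where "D = frechet_derivative \<psi> (at x0)"
  define E where "E = frechet_derivative \<phi> (at (\<psi> x0))"
  have D: "(\<psi> has_derivative D) (at x0)"
    using Ck_on_2_differentiable(1)[OF \<psi> U b] frechet_derivative_works by (auto simp: D_def)
  have E: "(\<phi> has_derivative E) (at (\<psi> x0))"
    using Ck_on_2_differentiable(1)[OF \<phi> V imageI[OF U(2)] b] frechet_derivative_works by (auto simp: E_def)
  have PD: "P x0 \<bullet> v = D v \<bullet> b" for v
  proof -
    have "(\<rho> has_derivative (\<lambda>v. D v \<bullet> b)) (at x0)"
      unfolding \<rho>_def by (rule bounded_linear.has_derivative[OF bounded_linear_inner_left D])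
    from has_derivative_unique[OF this jet2_at_has_derivative[OF jet[OF U(2)]]]
    show ?thesis by metis
  qed
  have ED: "E (D v) = v" for v
  proof -
    have "((\<lambda>x. \<phi> (\<psi> x)) has_derivative (\<lambda>v. E (D v))) (at x0)"
      by (rule has_derivative_compose[OF D E])
    then have "((\<lambda>x. x) has_derivative (\<lambda>v. E (D v))) (at x0)"
      by (rule has_derivative_transform_within_open[OF _ U]) (simp add: inv)
    from has_derivative_unique[OF this has_derivative_ident] show ?thesis by metis
  qed
  show "P x0 \<noteq> 0"
  proof
    assume "P x0 = 0"
    then have z: "D v \<bullet> b = 0" for v using PD by (metis inner_zero_left)
    have "linear D" using D by (rule has_derivative_linear)
    moreover have "inj D" using ED by (metis injI)
    ultimately have "surj D" by (rule linear_inj_imp_surj) 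
    then obtain v where "D v = b" by (metis surjD)
    then show False using z[of v] b by simp
  qed
  show "\<exists>\<gamma>. \<gamma> 0 = x0 \<and> (\<forall>\<^sub>F t in nhds 0. \<gamma> t \<in> frontier \<Omega>) \<and> (\<gamma> has_vector_derivative v) (at 0)"
    if v: "P x0 \<bullet> v = 0" for v
  proof (intro exI[of _ "\<lambda>t. \<phi> (\<psi> x0 + t *\<^sub>R D v)"] conjI)
    show "\<phi> (\<psi> x0 + 0 *\<^sub>R D v) = x0" using inv[OF U(2)] by simp
    have "\<forall>\<^sub>F z in nhds (\<psi> x0). z \<in> \<psi> ` U" using V U(2) by (intro eventually_nhds_in_open) auto
    then have "\<forall>\<^sub>F t in nhds (0::real). \<psi> x0 + t *\<^sub>R D v \<in> \<psi> ` U"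
      using line_tendsto[of "\<psi> x0" "D v"] by (auto simp: filterlim_iff)
    then show "\<forall>\<^sub>F t in nhds 0. \<phi> (\<psi> x0 + t *\<^sub>R D v) \<in> frontier \<Omega>"
    proof eventually_elim
      case (elim t)
      then obtain y where y: "y \<in> U" "\<psi> x0 + t *\<^sub>R D v = \<psi> y" by blast
      have "\<rho> y = \<rho> x0 + t * (D v \<bullet> b)" unfolding \<rho>_def y(2)[symmetric] by (simp add: inner_add_left)
      then have "\<rho> y = 0" using \<rho>0 v PD by simp
      then show ?case using fr[OF y(1)] inv[OF y(1)] y(2) by simp
    qed
    have "((\<lambda>t. \<phi> (\<psi> x0 + t *\<^sub>R D v)) has_derivative (\<lambda>s. E (s *\<^sub>R D v))) (at 0)"
      by (rule has_derivative_compose[of "\<lambda>t. \<psi> x0 + t *\<^sub>R D v" _ 0 _ \<phi>]) 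
        (use E in \<open>auto intro!: derivative_eq_intros\<close>)
    then show "((\<lambda>t. \<phi> (\<psi> x0 + t *\<^sub>R D v)) has_vector_derivative v) (at 0)"
      unfolding has_vector_derivative_def using linear_cmul[OF has_derivative_linear[OF E]] ED by simp
  qed
  show "isCont (\<lambda>x. H x (axis i 1)) x0" for i
  proof -
    have "continuous_on U (foldr pd [axis i 1, axis k 1] \<psi>)" for k
      using \<psi> unfolding Ck_on_def by (metis (no_types, lifting) axis_in_Basis_iff One_nat_def Suc_1 Basis_real_def
        bot.extremum insert_subset insertI1 length_Cons list.simps(15) list.size(3) empty_set order_refl)
    then have "isCont (\<lambda>x. pd (axis i 1) (pd (axis k 1) \<psi>) x) x0" for k
      using U by (auto simp: continuous_on_eq_continuous_at)
    then show ?thesis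
      unfolding H_def pd_def[of "axis i 1", symmetric] isCont_def
      by (intro tendsto_vec_lambda tendsto_inner tendsto_const)
  qed
qed

lemma defining_function_line:
  assumes j: "jet2_at \<rho> P H x" and "\<rho> x = 0" 
  shows "0 < P x \<bullet> v \<Longrightarrow> \<forall>\<^sub>F t in at_right 0. 0 < \<rho> (x + t *\<^sub>R v)"
    and "P x \<bullet> v < 0 \<Longrightarrow> \<forall>\<^sub>F t in at_right 0. \<rho> (x + t *\<^sub>R v) < 0"
proof -
  have d: "((\<lambda>t. \<rho> (x + t *\<^sub>R v)) has_real_derivative P x \<bullet> v) (at 0)"
    using jet2_at_compose(1)[OF j, of v, THEN eventually_nhds_x_imp_x] by simp
  show "\<forall>\<^sub>F t in at_right 0. 0 < \<rho> (x + t *\<^sub>R v)" if p: "0 < P x \<bullet> v"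
  proof -
    obtain d where "0 < d" "\<And>t. 0 < t \<Longrightarrow> t < d \<Longrightarrow> 0 < \<rho> (x + t *\<^sub>R v)"
      using has_real_derivative_pos_inc_right[OF d p] assms(2) by auto
    then show ?thesis by (intro eventually_at_rightI[of 0 d]) auto
  qed
  show "\<forall>\<^sub>F t in at_right 0. \<rho> (x + t *\<^sub>R v) < 0" if p: "P x \<bullet> v < 0"
  proof -
    obtain d where "0 < d" "\<And>t. 0 < t \<Longrightarrow> t < d \<Longrightarrow> \<rho> (x + t *\<^sub>R v) < 0"
      using has_real_derivative_neg_dec_right[OF d p] assms(2) by auto
    then show ?thesis by (intro eventually_at_rightI[of 0 d]) auto
  qed
qed

text \<open>The boundary curves of \<open>chart_defining_function\<close> force a normal to be a multiple of the gradient
  of the defining function; the length fixes the multiple up to sign, and the sign is negative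
  because the defining function is positive inside.\<close>

lemma chart_outward_unit_normal:
  fixes \<Omega> :: "(real^'n) set"
  assumes ch: "boundary_chart 2 \<alpha> \<Omega> x0 U \<psi> \<phi> b" and x0: "x0 \<in> frontier \<Omega>"
  defines "P \<equiv> \<lambda>y. \<chi> k. pd (axis k 1) \<psi> y \<bullet> b"
  shows "outward_unit_normal \<Omega> x0 = - (P x0 /\<^sub>R norm (P x0))"
proof -
  define \<rho> where "\<rho> x = \<psi> x \<bullet> b" for x
  define N where "N = P x0"
  have N_eq: "(\<chi> k. pd (axis k 1) \<psi> x0 \<bullet> b) = N" by (simp add: N_def P_def)
  note cd = chart_defining_function[OF ch x0, folded P_def \<rho>_def, unfolded N_eq]
  have N: "N \<noteq> 0" by (rule cd(5))
  have U: "open U" "x0 \<in> U" using ch by (auto simp: boundary_chart_def)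
  note line = defining_function_line[OF cd(1)[OF U(2)] cd(2), folded N_def]
  note inside = cd(3) and bdry = cd(4)
  have "is_outward_unit_normal \<Omega> x0 \<nu> \<longleftrightarrow> \<nu> = - (N /\<^sub>R norm N)" for \<nu>
  proof
    assume \<nu>: "\<nu> = - (N /\<^sub>R norm N)"
    show "is_outward_unit_normal \<Omega> x0 \<nu>"
      unfolding is_outward_unit_normal_def
    proof (intro conjI allI impI)
      show "norm \<nu> = 1" using N by (simp add: \<nu>)
    next
      fix \<gamma> :: "real \<Rightarrow> real^'n" and v
      assume *: "\<gamma> 0 = x0 \<and> (\<forall>\<^sub>F t in nhds 0. \<gamma> t \<in> frontier \<Omega>) \<and> (\<gamma> has_vector_derivative v) (at 0)"
      then have g: "(\<gamma> has_derivative (\<lambda>s. s *\<^sub>R v)) (at 0)" by (simp add: has_vector_derivative_def)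
      have "isCont \<gamma> 0" using g has_derivative_continuous by blast
      then have "(\<gamma> \<longlongrightarrow> x0) (nhds 0)" using * tendsto_at_iff_tendsto_nhds[of \<gamma> 0] by (simp add: isCont_def)
      then have "\<forall>\<^sub>F t in nhds 0. \<gamma> t \<in> U" using U by (auto simp: tendsto_def)
      moreover have "\<forall>\<^sub>F t in nhds 0. \<gamma> t \<in> frontier \<Omega>" using * by simp
      ultimately have z: "\<forall>\<^sub>F t in nhds 0. 0 = \<rho> (\<gamma> t)" by eventually_elim (use bdry in force)
      have "(\<rho> has_derivative (\<lambda>v. N \<bullet> v)) (at (\<gamma> 0))"
        using jet2_at_has_derivative[OF cd(1)[OF U(2)]] * by (simp add: N_def)
      from has_derivative_compose[OF g this]
      have d: "((\<lambda>t. \<rho> (\<gamma> t)) has_derivative (\<lambda>s. N \<bullet> (s *\<^sub>R v))) (at 0)" .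
      have "((\<lambda>t. \<rho> (\<gamma> t)) has_derivative (\<lambda>s. 0)) (at 0)"
        by (rule has_derivative_transform_eventually[OF has_derivative_const[of 0]])
          (use z in \<open>auto simp: eventually_at_filter eventually_mono dest: eventually_nhds_x_imp_x\<close>)
      from has_derivative_unique[OF d this] have "N \<bullet> v = 0" by (metis scaleR_one)
      then show "\<nu> \<bullet> v = 0" by (simp add: \<nu>)
    next
      have "N \<bullet> \<nu> < 0" using N by (simp add: \<nu> dot_square_norm power2_eq_square)
      from line(2)[OF this] eventually_line_at_right[OF U, of \<nu>]
      show "\<forall>\<^sub>F t in at_right 0. x0 + t *\<^sub>R \<nu> \<notin> closure \<Omega>"
      proof eventually_elim
        case (elim t)
        then show ?case using inside[OF elim(2)] bdry[OF elim(2)] closure_Un_frontier[of \<Omega>] by auto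
      qed
    qed
  next
    assume n: "is_outward_unit_normal \<Omega> x0 \<nu>"
    define k where "k = (N \<bullet> \<nu>) / (N \<bullet> N)"
    have "N \<bullet> (\<nu> - k *\<^sub>R N) = 0" using N by (simp add: inner_diff_right k_def)
    note orth = this
    obtain \<gamma> where "\<gamma> 0 = x0 \<and> (\<forall>\<^sub>F t in nhds 0. \<gamma> t \<in> frontier \<Omega>) \<and> (\<gamma> has_vector_derivative \<nu> - k *\<^sub>R N) (at 0)"
      using cd(6)[of "\<nu> - k *\<^sub>R N"] orth by blast
    then have "\<nu> \<bullet> (\<nu> - k *\<^sub>R N) = 0" using n unfolding is_outward_unit_normal_def by blast
    then have "(\<nu> - k *\<^sub>R N) \<bullet> (\<nu> - k *\<^sub>R N) = 0" using orth by (simp add: inner_diff_left)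
    then have \<nu>: "\<nu> = k *\<^sub>R N" by simp
    have "norm \<nu> = 1" using n by (simp add: is_outward_unit_normal_def)
    then have k: "\<bar>k\<bar> * norm N = 1" using \<nu> by simp
    have "\<not> 0 < N \<bullet> \<nu>"
    proof
      assume "0 < N \<bullet> \<nu>"
      from line(1)[OF this] eventually_line_at_right[OF U, of \<nu>]
      have "\<forall>\<^sub>F t in at_right 0. x0 + t *\<^sub>R \<nu> \<in> \<Omega>" by eventually_elim (use inside in auto)
      moreover have "\<forall>\<^sub>F t in at_right 0. x0 + t *\<^sub>R \<nu> \<notin> closure \<Omega>"
        using n by (simp add: is_outward_unit_normal_def)
      ultimately have "\<forall>\<^sub>F t in at_right (0::real). False"
        by eventually_elim (use closure_subset in blast)
      then show False by simp
    qed
    then have "\<not> 0 < k * (N \<bullet> N)" by (simp add: \<nu>)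
    moreover have "0 < N \<bullet> N" using N by simp
    ultimately have "k \<le> 0" by (metis mult_pos_pos not_le)
    then have "k = - inverse (norm N)" using k N by (simp add: field_simps)
    then show "\<nu> = - (N /\<^sub>R norm N)" using \<nu> by simp
  qed
  then have "is_outward_unit_normal \<Omega> x0 = (\<lambda>\<nu>. \<nu> = - (N /\<^sub>R norm N))" by (rule ext)
  then show ?thesis unfolding outward_unit_normal_def N_def by simp
qed

section \<open>The Hopf lemma at the boundary of the domain\<close>

lemma ndop_abs_le:
  fixes A :: "real^'n^'n"
  assumes "norm A \<le> M" "norm b \<le> C" "norm p \<le> B" "\<And>i. norm (H (axis i 1)) \<le> B"
  shows "\<bar>ndop A b p H\<bar> \<le> real CARD('n) * (M * B) + C * B"
proof -
  have "\<bar>A $ i \<bullet> H (axis i 1)\<bar> \<le> M * B" for i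
  proof -
    have "\<bar>A $ i \<bullet> H (axis i 1)\<bar> \<le> norm (A $ i) * norm (H (axis i 1))" by (rule Cauchy_Schwarz_ineq2)
    also have "\<dots> \<le> M * B" using assms(1) assms(4)[of i] Finite_Cartesian_Product.norm_nth_le[of A i] norm_ge_zero[of A]
      by (intro mult_mono) (linarith | simp)+
    finally show ?thesis .
  qed
  then have "\<bar>\<Sum>i\<in>UNIV. A $ i \<bullet> H (axis i 1)\<bar> \<le> real CARD('n) * (M * B)"
    using sum_bounded_above[of UNIV "\<lambda>i. \<bar>A $ i \<bullet> H (axis i 1)\<bar>" "M * B"] 
    by (intro order_trans[OF sum_abs]) simp
  moreover have "\<bar>b \<bullet> p\<bar> \<le> C * B"
  proof -
    have "\<bar>b \<bullet> p\<bar> \<le> norm b * norm p" by (rule Cauchy_Schwarz_ineq2)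
    also have "\<dots> \<le> C * B" using assms(2,3) norm_ge_zero[of b] by (intro mult_mono) (linarith | simp)+
    finally show ?thesis .
  qed
  ultimately show ?thesis unfolding ndop_def by linarith
qed

lemma chart_normal_derivative:
  fixes \<Omega> :: "(real^'n) set"
  assumes ch: "boundary_chart 2 \<alpha> \<Omega> x0 U \<psi> \<phi> b" and x0: "x0 \<in> frontier \<Omega>"
  shows "norm (outward_unit_normal \<Omega> x0) = 1"
    and "0 < (\<chi> k. pd (axis k 1) \<psi> x0 \<bullet> b) \<bullet> d \<longleftrightarrow> outward_unit_normal \<Omega> x0 \<bullet> d < 0"
proof -
  define N where "N = (\<chi> k. pd (axis k 1) \<psi> x0 \<bullet> b)"
  have N: "N \<noteq> 0" using chart_defining_function(5)[OF ch x0] by (simp add: N_def)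
  have n: "outward_unit_normal \<Omega> x0 = - (N /\<^sub>R norm N)"
    using chart_outward_unit_normal[OF ch x0] by (simp add: N_def)
  show "norm (outward_unit_normal \<Omega> x0) = 1" using N by (simp add: n)
  show "0 < N \<bullet> d \<longleftrightarrow> outward_unit_normal \<Omega> x0 \<bullet> d < 0"
    using N by (simp add: n zero_less_mult_iff)
qed

lemma inward_line:
  fixes \<Omega> :: "(real^'n) set"
  assumes ch: "boundary_chart 2 \<alpha> \<Omega> x0 U \<psi> \<phi> b" and x0: "x0 \<in> frontier \<Omega>"
    and d: "outward_unit_normal \<Omega> x0 \<bullet> d < 0"
  shows "\<forall>\<^sub>F t in at_right 0. x0 + t *\<^sub>R d \<in> \<Omega>"
proof -
  have U: "open U" "x0 \<in> U" using ch by (auto simp: boundary_chart_def)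
  note cd = chart_defining_function[OF ch x0]
  have "0 < (\<chi> k. pd (axis k 1) \<psi> x0 \<bullet> b) \<bullet> d" using chart_normal_derivative(2)[OF ch x0] d by blast
  from defining_function_line(1)[OF cd(1)[OF U(2)] cd(2) this] eventually_line_at_right[OF U, of d]
  show ?thesis by eventually_elim (use cd(3) in auto)
qed

lemma hopf_at_chart:
  fixes \<Omega> :: "(real^'n) set"
  assumes ch: "boundary_chart 2 \<alpha> \<Omega> x0 U \<psi> \<phi> b" and x0: "x0 \<in> frontier \<Omega>"
    and "0 < c" "0 \<le> C" "0 \<le> Q"
    and ell: "\<And>x. x \<in> \<Omega> \<Longrightarrow> elliptic_bound c C (A x) (\<beta> x)"
    and AM: "\<And>x. x \<in> \<Omega> \<Longrightarrow> norm (A x) \<le> M"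
    and cw: "continuous_on (closure \<Omega>) w"
    and w0: "\<And>x. x \<in> frontier \<Omega> \<Longrightarrow> w x = 0"
    and wpos: "\<And>x. x \<in> \<Omega> \<Longrightarrow> 0 < w x"
    and jw: "\<And>x. x \<in> \<Omega> \<Longrightarrow> jet2_at w W (Hw x) x"
    and Lw: "\<And>x. x \<in> \<Omega> \<Longrightarrow> ndop (A x) (\<beta> x) (W x) (Hw x) \<le> Q * w x"
    and d: "outward_unit_normal \<Omega> x0 \<bullet> d < 0"
  shows "\<exists>e>0. \<forall>\<^sub>F t in at_right 0. e * t \<le> w (x0 + t *\<^sub>R d)"
proof -
  define \<rho> where "\<rho> x = \<psi> x \<bullet> b" for x
  define P where "P = (\<lambda>y. \<chi> k. pd (axis k 1) \<psi> y \<bullet> b)"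
  define H where "H = (\<lambda>x v. \<chi> k. frechet_derivative (pd (axis k 1) \<psi>) (at x) v \<bullet> b)"
  have U: "open U" "x0 \<in> U" using ch by (auto simp: boundary_chart_def)
  have jet: "\<And>x. x \<in> U \<Longrightarrow> jet2_at \<rho> P (H x) x"
    using chart_defining_function(1)[OF ch x0] unfolding P_def H_def \<rho>_def .
  have \<rho>0: "\<rho> x0 = 0" unfolding \<rho>_def by (rule chart_defining_function(2)[OF ch x0])
  have ins: "0 < \<rho> x \<longleftrightarrow> x \<in> \<Omega>" "\<rho> x = 0 \<longleftrightarrow> x \<in> frontier \<Omega>" if "x \<in> U" for x
    unfolding \<rho>_def using chart_defining_function(3,4)[OF ch x0 that] by blast+
  have contP: "isCont P x0" using jet[OF U(2)] has_derivative_continuous unfolding jet2_at_def by blast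
  have contH: "isCont (\<lambda>x. H x (axis i 1)) x0" for i
    unfolding H_def by (rule chart_defining_function(7)[OF ch x0])
  have Pd: "0 < P x0 \<bullet> d" using chart_normal_derivative(2)[OF ch x0, of d] d by (simp add: P_def)
  \<comment> \<open>By continuity \<open>B\<close> bounds the first and second derivatives of \<open>\<rho>\<close> near \<open>x0\<close>.\<close>
  define B where "B = norm (P x0) + 1 + (\<Sum>i\<in>UNIV. norm (H x0 (axis i 1)) + 1)"
  have HB: "norm (H x0 (axis i 1)) + 1 \<le> B" for i
  proof -
    have "norm (H x0 (axis i 1)) + 1 \<le> (\<Sum>i\<in>UNIV. norm (H x0 (axis i 1)) + 1)"
      by (rule member_le_sum) (auto intro: add_nonneg_nonneg)
    then show ?thesis by (simp add: B_def add_increasing)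
  qed
  have PB: "norm (P x0) + 1 \<le> B" unfolding B_def by (simp add: sum_nonneg add_nonneg_nonneg)
  have loc: "\<forall>\<^sub>F x in nhds x0. norm (f x) < norm (f x0) + 1" if "isCont f x0" for f :: "real^'n \<Rightarrow> real^'n"
  proof -
    have "((\<lambda>x. norm (f x)) \<longlongrightarrow> norm (f x0)) (nhds x0)"
      using that tendsto_at_iff_tendsto_nhds[of f x0] by (intro tendsto_norm) (simp add: isCont_def)
    then show ?thesis by (rule order_tendstoD(2)) simp
  qed
  have "\<forall>\<^sub>F x in nhds x0. \<forall>i. norm (H x (axis i 1)) < norm (H x0 (axis i 1)) + 1"
    using loc[OF contH] by (rule eventually_all_finite)
  with loc[OF contP] eventually_nhds_in_open[OF U]
  have "\<forall>\<^sub>F x in nhds x0. x \<in> U \<and> norm (P x) \<le> B \<and> (\<forall>i. norm (H x (axis i 1)) \<le> B)"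
  proof eventually_elim
    case (elim x)
    then have "norm (P x) \<le> B" using PB by linarith
    moreover have "norm (H x (axis i 1)) \<le> B" for i
      using elim(3) HB[of i] by (meson less_le_trans less_imp_le)
    ultimately show ?case using elim(2) by blast
  qed
  then obtain r where r: "0 < r" "\<And>x. x \<in> ball x0 r \<Longrightarrow> x \<in> U"
    "\<And>x. x \<in> ball x0 r \<Longrightarrow> norm (P x) \<le> B" "\<And>x i. x \<in> ball x0 r \<Longrightarrow> norm (H x (axis i 1)) \<le> B"
    by (auto simp: eventually_nhds_metric dist_commute)
  define D where "D = max C (real CARD('n) * (M * B) + C * B)"
  show ?thesis
  proof (rule hopf[where c = c and C = D and Q = Q and s = r and \<rho> = \<rho> and P = P and H = H and A = A and b = \<beta>
        and W = W and Hw = Hw])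
    fix x assume x: "x \<in> ball x0 r"
    note xU = r(2)[OF x]
    show "jet2_at \<rho> P (H x) x" by (rule jet[OF xU])
    show "\<rho> x = 0 \<Longrightarrow> 0 \<le> w x" using ins(2)[OF xU] w0 by simp
    assume "0 < \<rho> x"
    then have x\<Omega>: "x \<in> \<Omega>" using ins(1)[OF xU] by simp
    show "elliptic_bound c D (A x) (\<beta> x)"
      using ell[OF x\<Omega>] unfolding elliptic_bound_def D_def by (auto simp: le_max_iff_disj)
    have "norm (\<beta> x) \<le> C" using ell[OF x\<Omega>] by (simp add: elliptic_bound_def)
    then have "\<bar>ndop (A x) (\<beta> x) (P x) (H x)\<bar> \<le> real CARD('n) * (M * B) + C * B"
      by (rule ndop_abs_le[OF AM[OF x\<Omega>] _ r(3)[OF x]]) (rule r(4)[OF x])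
    then show "\<bar>ndop (A x) (\<beta> x) (P x) (H x)\<bar> \<le> D" by (simp add: D_def)
    show "0 < w x" "jet2_at w W (Hw x) x" "ndop (A x) (\<beta> x) (W x) (Hw x) \<le> Q * w x"
      using wpos jw Lw x\<Omega> by auto
  next
    show "continuous_on (ball x0 r \<inter> {x. 0 \<le> \<rho> x}) w"
    proof (rule continuous_on_subset[OF cw], rule subsetI)
      fix x assume "x \<in> ball x0 r \<inter> {x. 0 \<le> \<rho> x}"
      then show "x \<in> closure \<Omega>" using ins[OF r(2), of x] closure_Un_frontier[of \<Omega>] by (cases "\<rho> x = 0") auto
    qed
  qed (use \<open>0 < c\<close> \<open>0 \<le> C\<close> \<open>0 \<le> Q\<close> r(1) \<rho>0 Pd in \<open>simp_all add: D_def le_max_iff_disj\<close>)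
qed

text \<open>The gradient of \<open>w\<close> is available only inside \<open>\<Omega>\<close>, so the slope at the boundary point is compared with
  the limit \<open>p\<close> of the gradient through the mean value theorem on the segment from \<open>x0\<close> into \<open>\<Omega>\<close>.\<close>

lemma boundary_gradient_lower_bound:
  fixes x0 d :: "real^'n"
  assumes line: "\<forall>\<^sub>F t in at_right 0. x0 + t *\<^sub>R d \<in> \<Omega>" and x0: "x0 \<in> closure \<Omega>"
    and cw: "continuous_on (closure \<Omega>) w" and w0: "w x0 = 0"
    and der: "\<And>x. x \<in> \<Omega> \<Longrightarrow> (w has_derivative (\<lambda>v. W x \<bullet> v)) (at x)"
    and lim: "(W \<longlongrightarrow> p) (at x0 within \<Omega>)" and nx0: "x0 \<notin> \<Omega>"
    and low: "\<forall>\<^sub>F t in at_right 0. e * t \<le> w (x0 + t *\<^sub>R d)"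
  shows "e \<le> p \<bullet> d"
proof (rule ccontr)
  assume neg: "\<not> e \<le> p \<bullet> d"
  have "((\<lambda>x. W x \<bullet> d) \<longlongrightarrow> p \<bullet> d) (at x0 within \<Omega>)" by (intro tendsto_intros lim)
  then have "\<forall>\<^sub>F x in at x0 within \<Omega>. W x \<bullet> d < e" using neg by (intro order_tendstoD(2)) auto
  then have ev: "\<forall>\<^sub>F x in nhds x0. x \<in> \<Omega> \<longrightarrow> W x \<bullet> d < e"
    unfolding eventually_at_filter by eventually_elim (use nx0 in auto)
  have "\<forall>\<^sub>F t in nhds (0::real). x0 + t *\<^sub>R d \<in> \<Omega> \<longrightarrow> W (x0 + t *\<^sub>R d) \<bullet> d < e"
    by (rule eventually_compose_filterlim[OF ev line_tendsto])
  then have "\<forall>\<^sub>F t in at_right (0::real). x0 + t *\<^sub>R d \<in> \<Omega> \<longrightarrow> W (x0 + t *\<^sub>R d) \<bullet> d < e"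
    by (rule filter_leD[OF at_within_le_nhds])
  with line low have "\<forall>\<^sub>F t in at_right 0. x0 + t *\<^sub>R d \<in> \<Omega> \<and> W (x0 + t *\<^sub>R d) \<bullet> d < e \<and> e * t \<le> w (x0 + t *\<^sub>R d)"
    by eventually_elim auto
  then obtain \<tau> where "0 < \<tau>" and *: "\<forall>t>0. t < \<tau> \<longrightarrow>
      x0 + t *\<^sub>R d \<in> \<Omega> \<and> W (x0 + t *\<^sub>R d) \<bullet> d < e \<and> e * t \<le> w (x0 + t *\<^sub>R d)"
    unfolding eventually_at_right_field by blast
  then have \<tau>: "0 < \<tau>" "\<And>t. 0 < t \<Longrightarrow> t < \<tau> \<Longrightarrow> x0 + t *\<^sub>R d \<in> \<Omega>"
    "\<And>t. 0 < t \<Longrightarrow> t < \<tau> \<Longrightarrow> W (x0 + t *\<^sub>R d) \<bullet> d < e" "\<And>t. 0 < t \<Longrightarrow> t < \<tau> \<Longrightarrow> e * t \<le> w (x0 + t *\<^sub>R d)"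
    by blast+
  define t where "t = \<tau> / 2"
  have t: "0 < t" "t < \<tau>" using \<tau>(1) by (auto simp: t_def)
  have D: "((\<lambda>t. w (x0 + t *\<^sub>R d)) has_real_derivative W (x0 + s *\<^sub>R d) \<bullet> d) (at s)" if "0 < s" "s < \<tau>" for s
    using der[OF \<tau>(2)[OF that]] by (rule has_real_derivative_line)
  have "continuous_on {0..t} (\<lambda>t. w (x0 + t *\<^sub>R d))"
  proof (rule continuous_on_compose2[OF cw])
    show "(\<lambda>t. x0 + t *\<^sub>R d) ` {0..t} \<subseteq> closure \<Omega>"
    proof
      fix y assume "y \<in> (\<lambda>t. x0 + t *\<^sub>R d) ` {0..t}"
      then obtain s where s: "y = x0 + s *\<^sub>R d" "s \<in> {0..t}" by (rule imageE)
      show "y \<in> closure \<Omega>"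
      proof (cases "s = 0")
        case True then show ?thesis using s x0 by simp
      next
        case False
        then have "x0 + s *\<^sub>R d \<in> \<Omega>" using s(2) t by (intro \<tau>(2)) auto
        then show ?thesis unfolding s(1) using closure_subset by blast
      qed
    qed
  qed (intro continuous_intros)
  moreover have "(\<lambda>t. w (x0 + t *\<^sub>R d)) differentiable (at s)" if "0 < s" "s < t" for s
    using D[of s] that t by (auto simp: real_differentiable_def)
  ultimately have "\<exists>l z. 0 < z \<and> z < t \<and> ((\<lambda>t. w (x0 + t *\<^sub>R d)) has_real_derivative l) (at z) \<and>
    w (x0 + t *\<^sub>R d) - w (x0 + 0 *\<^sub>R d) = (t - 0) * l"
    by (rule MVT[OF t(1)])
  then obtain l z where z: "0 < z" "z < t" "((\<lambda>t. w (x0 + t *\<^sub>R d)) has_real_derivative l) (at z)"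
    "w (x0 + t *\<^sub>R d) - w (x0 + 0 *\<^sub>R d) = (t - 0) * l"
    by blast
  have "l = W (x0 + z *\<^sub>R d) \<bullet> d" using DERIV_unique[OF z(3) D[of z]] z t by auto
  then have "l < e" using \<tau>(3)[of z] z t by simp
  then have "w (x0 + t *\<^sub>R d) < e * t" using z(4) w0 t(1) by (simp add: mult.commute)
  then show False using \<tau>(4)[OF t] by simp
qed

text \<open>The limits in the definition of the conormal derivative exist, because the derivatives extend
  continuously to the closure.\<close>

lemma Ck_closure_grad_limit:
  fixes u :: "real^'n \<Rightarrow> real"
  assumes u: "Ck_closure 2 \<Omega> u" and x0: "x0 \<in> closure \<Omega>" "x0 \<notin> \<Omega>"
  shows "(grad u \<longlongrightarrow> (\<chi> j. Lim (at x0 within \<Omega>) (pd (axis j 1) u))) (at x0 within \<Omega>)"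
proof -
  have nt: "\<not> trivial_limit (at x0 within \<Omega>)"
    using x0 by (simp add: trivial_limit_within closure_def)
  have "(pd (axis j 1) u \<longlongrightarrow> Lim (at x0 within \<Omega>) (pd (axis j 1) u)) (at x0 within \<Omega>)" for j
  proof -
    have *: "\<forall>bs. set bs \<subseteq> Basis \<and> length bs \<le> 2 \<longrightarrow>
        (\<exists>h. continuous_on (closure \<Omega>) h \<and> (\<forall>x\<in>\<Omega>. h x = foldr pd bs u x))"
      using u unfolding Ck_closure_def by blast
    obtain h where h: "continuous_on (closure \<Omega>) h" "\<forall>x\<in>\<Omega>. h x = pd (axis j 1) u x"
      using *[rule_format, of "[axis j 1]"] by auto
    have "(h \<longlongrightarrow> h x0) (at x0 within closure \<Omega>)" using h(1) x0(1) by (simp add: continuous_on_def)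
    then have "(h \<longlongrightarrow> h x0) (at x0 within \<Omega>)" by (rule tendsto_within_subset) (rule closure_subset)
    then have l: "(pd (axis j 1) u \<longlongrightarrow> h x0) (at x0 within \<Omega>)"
      by (rule Lim_transform_eventually) (use h(2) in \<open>auto simp: eventually_at_filter\<close>)
    then show ?thesis using tendsto_Lim[OF nt l] by simp
  qed
  then show ?thesis unfolding grad_def[abs_def] by (rule tendsto_vec_lambda)
qed

lemma conormal_derivative_eq_inner:
  "conormal_derivative \<Omega> a u x =
     (\<chi> j. Lim (at x within \<Omega>) (pd (axis j 1) u)) \<bullet> (transpose (a x) *v outward_unit_normal \<Omega> x)"
proof -
  have "conormal_derivative \<Omega> a u x = (\<Sum>j\<in>UNIV. \<Sum>i\<in>UNIV.
      a x $ i $ j * Lim (at x within \<Omega>) (pd (axis j 1) u) * outward_unit_normal \<Omega> x $ i)"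
    unfolding conormal_derivative_def by (rule sum.swap)
  then show ?thesis
    by (simp add: inner_vec_def matrix_vector_mult_def transpose_def sum_distrib_left mult_ac)
qed

section \<open>The sign of an analytic function next to a zero\<close>

lemma real_analytic_on_diff:
  assumes "real_analytic_on S f" "real_analytic_on S g"
  shows "real_analytic_on S (\<lambda>x. f x - g x)"
  unfolding real_analytic_on_def
proof
  fix x assume x: "x \<in> S"
  obtain r c where f: "r > 0" "\<And>y. \<bar>y - x\<bar> < r \<Longrightarrow> (\<lambda>m. c m * (y - x) ^ m) sums f y"
    using assms(1) x unfolding real_analytic_on_def by blast
  obtain s d where g: "s > 0" "\<And>y. \<bar>y - x\<bar> < s \<Longrightarrow> (\<lambda>m. d m * (y - x) ^ m) sums g y"
    using assms(2) x unfolding real_analytic_on_def by blast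
  show "\<exists>r>0. \<exists>c. \<forall>y. \<bar>y - x\<bar> < r \<longrightarrow> (\<lambda>m. c m * (y - x) ^ m) sums (f y - g y)"
  proof (intro exI[of _ "min r s"] exI[of _ "\<lambda>m. c m - d m"] conjI allI impI)
    show "(\<lambda>m. (c m - d m) * (y - x) ^ m) sums (f y - g y)" if "\<bar>y - x\<bar> < min r s" for y
      using sums_diff[OF f(2) g(2), of y] that by (simp add: left_diff_distrib)
  qed (use f g in simp)
qed

text \<open>Either all coefficients of the power series at \<open>x\<close> vanish, or \<open>x\<close> is an isolated zero.\<close>

lemma real_analytic_zero_dichotomy:
  assumes "real_analytic_on UNIV f" "f x = 0"
  shows "(\<forall>\<^sub>F y in nhds x. f y = 0) \<or> (\<forall>\<^sub>F y in at x. f y \<noteq> 0)"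
proof -
  obtain r c where f: "r > 0" "\<And>y. \<bar>y - x\<bar> < r \<Longrightarrow> (\<lambda>m. c m * (y - x) ^ m) sums f y"
    using assms(1) unfolding real_analytic_on_def by blast
  have "(\<lambda>m. c m * 0 ^ m) sums 0" using f(2)[of x] f(1) assms(2) by simp
  then have c0: "c 0 = 0" using powser_sums_zero[of c] sums_unique2 by blast
  show ?thesis
  proof (cases "\<exists>m. c m \<noteq> 0")
    case True
    then obtain m where m: "c m \<noteq> 0" by blast
    then have "m > 0" using c0 by (cases m) auto
    obtain s where s: "0 < s" "\<And>z. z \<in> cball x s - {x} \<Longrightarrow> f z \<noteq> 0"
      using powser_0_nonzero[of r x c f m] f assms(2) m \<open>m > 0\<close> by (auto simp: real_norm_def)
    then have "\<forall>\<^sub>F y in at x. f y \<noteq> 0"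
      unfolding eventually_at by (intro exI[of _ s]) (auto simp: dist_commute)
    then show ?thesis ..
  next
    case False
    then have "f y = 0" if "\<bar>y - x\<bar> < r" for y
      using f(2)[OF that] sums_unique2[OF _ sums_zero] by simp
    then have "\<forall>\<^sub>F y in nhds x. f y = 0"
      unfolding eventually_nhds_metric using f(1) by (auto simp: dist_real_def)
    then show ?thesis ..
  qed
qed

text \<open>The set \<open>Z\<close> of points near which \<open>f\<close> vanishes is open, and by the dichotomy so is its complement.
  As \<open>y0\<close> is not in it, \<open>Z\<close> is empty; so the zero \<open>x0\<close> is isolated and the intermediate value
  theorem excludes a change of sign to its right.\<close>

lemma real_analytic_right_sign:
  assumes an: "real_analytic_on UNIV f" and cont: "continuous_on UNIV f" and "f x0 = 0" "f y0 \<noteq> 0"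
  shows "\<exists>e>0. (\<forall>t\<in>{x0<..x0 + e}. 0 < f t) \<or> (\<forall>t\<in>{x0<..x0 + e}. f t < 0)"
proof -
  define Z where "Z = {x. \<forall>\<^sub>F y in nhds x. f y = 0}"
  have "open Z"
    unfolding Z_def open_subopen[of "Collect _"]
    by (auto simp: eventually_nhds)
  moreover have "open (- Z)"
  proof (subst open_subopen, rule ballI)
    fix x assume x: "x \<in> - Z"
    have iso: "\<forall>\<^sub>F y in at x. f y \<noteq> 0"
    proof (cases "f x = 0")
      case True
      then show ?thesis using real_analytic_zero_dichotomy[OF an True] x by (auto simp: Z_def)
    next
      case False
      have "(f \<longlongrightarrow> f x) (at x)" using cont by (simp add: continuous_on_def)
      then show ?thesis using False by (rule tendsto_imp_eventually_ne)
    qed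
    have "\<forall>\<^sub>F y in at x. y \<in> - Z"
      using iso by eventually_elim (auto simp: Z_def dest: eventually_nhds_x_imp_x)
    then have "\<forall>\<^sub>F y in nhds x. y \<in> - Z"
      unfolding eventually_at_filter by eventually_elim (use x in auto)
    then show "\<exists>T. open T \<and> x \<in> T \<and> T \<subseteq> - Z" unfolding eventually_nhds by auto
  qed
  ultimately have "Z = {} \<or> Z = UNIV"
    using clopen[of Z] by (simp add: closed_def)
  moreover have "y0 \<notin> Z" using assms(4) by (auto simp: Z_def dest: eventually_nhds_x_imp_x)
  ultimately have "x0 \<notin> Z" by auto
  then have "\<forall>\<^sub>F y in at x0. f y \<noteq> 0"
    using real_analytic_zero_dichotomy[OF an assms(3)] by (simp add: Z_def)
  then obtain s where s: "s > 0" "\<And>y. y \<noteq> x0 \<Longrightarrow> dist y x0 < s \<Longrightarrow> f y \<noteq> 0"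
    by (auto simp: eventually_at)
  define e where "e = s / 2"
  have e: "0 < e" using s by (simp add: e_def)
  have nz: "f t \<noteq> 0" if "t \<in> {x0<..x0+e}" for t
    using s(2)[of t] s(1) that by (auto simp: dist_real_def e_def)
  have conn: "connected (f ` {x0<..x0+e})"
    by (intro connected_continuous_image continuous_on_subset[OF cont] connected_Ioc) auto
  show ?thesis
  proof (intro exI[of _ e] conjI e)
    show "(\<forall>t\<in>{x0<..x0 + e}. 0 < f t) \<or> (\<forall>t\<in>{x0<..x0 + e}. f t < 0)"
    proof (rule ccontr)
      assume "\<not> ?thesis"
      then obtain p q where "p \<in> {x0<..x0+e}" "q \<in> {x0<..x0+e}" "f p \<le> 0" "0 \<le> f q" by (auto simp: not_less)
      then have "0 \<in> f ` {x0<..x0+e}" using connectedD_interval[OF conn, of "f p" "f q" 0] by blast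
      then show False using nz by auto
    qed
  qed
qed

section \<open>Comparison of conormal derivatives\<close>

lemma Ck_on_2_continuous: "Ck_on 2 S f \<Longrightarrow> continuous_on S f"
  unfolding Ck_on_def by (metis empty_set empty_subsetI foldr.simps(1) id_apply le0 list.size(3))

lemma Ck_on_2_locally_Lipschitz:
  fixes F :: "real \<Rightarrow> real"
  assumes "Ck_on 2 UNIV F"
  shows "\<exists>Q\<ge>0. \<forall>s\<in>{-B..B}. \<forall>t\<in>{-B..B}. \<bar>F s - F t\<bar> \<le> Q * \<bar>s - t\<bar>"
proof -
  have *: "\<forall>bs. set bs \<subseteq> Basis \<and> length bs \<le> 2 \<longrightarrow> continuous_on UNIV (foldr pd bs F)"
    using assms unfolding Ck_on_def by blast
  have "continuous_on UNIV (pd 1 F)" using *[rule_format, of "[1]"] by simp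
  then have "continuous_on {-B..B} (pd 1 F)" by (rule continuous_on_subset) simp
  then have "bounded (pd 1 F ` {-B..B})" by (intro compact_imp_bounded compact_continuous_image) auto
  then obtain Q where Q: "\<forall>t\<in>{-B..B}. \<bar>pd 1 F t\<bar> \<le> Q" by (auto simp: bounded_iff)
  have der: "(F has_real_derivative pd 1 F t) (at t)" for t
  proof -
    have d: "(F has_derivative frechet_derivative F (at t)) (at t)"
      using Ck_on_2_differentiable(1)[OF assms open_UNIV, of t 1] frechet_derivative_works by auto
    then show ?thesis
      unfolding has_field_derivative_def pd_def
    proof (rule has_derivative_eq_rhs)
      have lin: "linear (frechet_derivative F (at t))" using d by (rule has_derivative_linear)
      show "frechet_derivative F (at t) = (*) (frechet_derivative F (at t) 1)"
      proof
        fix h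
        have "frechet_derivative F (at t) h = h * frechet_derivative F (at t) 1"
          using linear_cmul[OF lin, of h 1] unfolding real_scaleR_def mult_1_right .
        then show "frechet_derivative F (at t) h = frechet_derivative F (at t) 1 * h"
          by (rule trans) (rule mult.commute)
      qed
    qed
  qed
  have "\<bar>F s - F t\<bar> \<le> max 0 Q * \<bar>s - t\<bar>" if "s \<in> {-B..B}" "t \<in> {-B..B}" for s t
  proof -
    have "norm (F s - F t) \<le> max 0 Q * norm (s - t)"
    proof (rule field_differentiable_bound[where S = "{-B..B}" and f' = "pd 1 F"])
      show "(F has_field_derivative pd 1 F z) (at z within {-B..B})" for z
        using der by (rule has_field_derivative_at_within)
      show "norm (pd 1 F z) \<le> max 0 Q" if "z \<in> {-B..B}" for z
        using Q that by (simp add: le_max_iff_disj)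
    qed (use that in auto)
    then show ?thesis by simp
  qed
  moreover have "0 \<le> max 0 Q" by simp
  ultimately show ?thesis by blast
qed

text \<open>The solution with the larger source is larger inside \<open>\<Omega>\<close>, and both agree on the boundary; the
  Hopf lemma along the inward direction \<open>- \<eta>\<close> makes the comparison of conormal derivatives strict.\<close>

lemma conormal_derivative_strict_comparison:
  fixes \<Omega> :: "(real^'n) set"
  assumes dom: "open \<Omega>" "connected \<Omega>" "bounded \<Omega>" "Ck_holder_boundary 2 \<alpha> \<Omega>"
    and areg: "Ck_closure 2 \<Omega> a"
    and asym: "\<And>x i j. x \<in> closure \<Omega> \<Longrightarrow> a x $ i $ j = a x $ j $ i"
    and c: "0 < c" and aell: "\<And>x v. x \<in> closure \<Omega> \<Longrightarrow> c * (norm v)\<^sup>2 \<le> v \<bullet> (a x *v v)"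
    and F: "antimono F" "F 0 = 0" and G: "antimono G" "G 0 = 0" "Ck_on 2 UNIV G"
    and u: "dirichlet_solution \<alpha> \<Omega> a F h u" and v: "dirichlet_solution \<alpha> \<Omega> a G h v"
    and FG: "\<And>t. 0 < t \<Longrightarrow> t \<le> e \<Longrightarrow> G t < F t"
    and h: "\<And>x. x \<in> frontier \<Omega> \<Longrightarrow> 0 \<le> h x \<and> h x \<le> e" and hpos: "y0 \<in> frontier \<Omega>" "0 < h y0"
    and x0: "x0 \<in> frontier \<Omega>"
  shows "conormal_derivative \<Omega> a u x0 < conormal_derivative \<Omega> a v x0"
proof -
  obtain C where C: "0 \<le> C" and ell: "\<And>x. x \<in> \<Omega> \<Longrightarrow> elliptic_bound c C (a x) (drift a x)"
    using elliptic_bound_coefficients[OF dom(1,3) areg asym c aell] by blast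
  have frc: "frontier \<Omega> \<subseteq> closure \<Omega>" by (simp add: frontier_def)
  have e0: "0 < e" using h[OF hpos(1)] hpos(2) by linarith
  have ureg: "Ck_closure 2 \<Omega> u" "Ck_on 2 \<Omega> u" "continuous_on (closure \<Omega>) u"
    and vreg: "Ck_closure 2 \<Omega> v" "Ck_on 2 \<Omega> v" "continuous_on (closure \<Omega>) v"
    using u v by (auto simp: dirichlet_solution_def Ck_holder_closure_def Ck_closure_def)
  have ubd: "u x = h x" and vbd: "v x = h x" if "x \<in> frontier \<Omega>" for x
    using u v that by (auto simp: dirichlet_solution_def)
  have ju: "jet2_at u (grad u) (hess u x) x" and jv: "jet2_at v (grad v) (hess v x) x" if "x \<in> \<Omega>" for x
    using Ck_on_2_jet2_grad[OF _ dom(1) that] ureg vreg by auto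
  have Lu: "ndop (a x) (drift a x) (grad u x) (hess u x) = - F (u x)"
    and Lv: "ndop (a x) (drift a x) (grad v x) (hess v x) = - G (v x)" if x: "x \<in> \<Omega>" for x
    using elliptic_op_eq_ndop[OF dom(1,3) areg asym c aell ureg(2) x]
      elliptic_op_eq_ndop[OF dom(1,3) areg asym c aell vreg(2) x] u v x
    by (auto simp: dirichlet_solution_def)
  have u0: "0 \<le> u x" if x: "x \<in> \<Omega>" for x
  proof (rule weak_minimum_principle[OF dom(1-3) c C ell ju ureg(3) _ _ x])
    show "0 \<le> u x" if "x \<in> frontier \<Omega>" for x using h[OF that] ubd[OF that] by simp
    show "ndop (a x) (drift a x) (grad u x) (hess u x) \<le> 0" if "x \<in> \<Omega>" "u x < 0" for x
      using Lu[OF that(1)] antimonoD[OF F(1), of "u x" 0] that F(2) by simp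
  qed
  \<comment> \<open>The bounds \<open>u0\<close> and \<open>ue\<close> keep \<open>u\<close> in the range where the sources are ordered.\<close>
  have ue: "u x \<le> e" if x: "x \<in> \<Omega>" for x
  proof -
    have "0 \<le> - 1 * u x + e"
    proof (rule weak_minimum_principle[OF dom(1-3) c C ell jet2_at_affine(1)[OF ju] _ _ _ x])
      show "continuous_on (closure \<Omega>) (\<lambda>x. - 1 * u x + e)" by (intro continuous_intros ureg(3))
      show "0 \<le> - 1 * u x + e" if "x \<in> frontier \<Omega>" for x using h[OF that] ubd[OF that] by simp
      fix x assume x: "x \<in> \<Omega>" "- 1 * u x + e < 0"
      then have "F (u x) \<le> F 0" using e0 by (intro antimonoD[OF F(1)]) simp
      then show "ndop (a x) (drift a x) (- 1 *\<^sub>R grad u x) (\<lambda>v. - 1 *\<^sub>R hess u x v) \<le> 0"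
        unfolding jet2_at_affine(2)[OF ju[OF x(1)]] Lu[OF x(1)] using F(2) by simp
    qed
    then show ?thesis by simp
  qed
  have GF: "G (u x) \<le> F (u x)" if x: "x \<in> \<Omega>" for x
    using FG[of "u x"] u0[OF x] ue[OF x] F(2) G(2) by (cases "u x = 0") auto
  define w where "w = (\<lambda>x. 1 * u x + - 1 * v x + 0)"
  define W where "W = (\<lambda>x. 1 *\<^sub>R grad u x + - 1 *\<^sub>R grad v x)"
  define Hw where "Hw = (\<lambda>x d. 1 *\<^sub>R hess u x d + - 1 *\<^sub>R hess v x d)"
  have jw: "jet2_at w W (Hw x) x" if "x \<in> \<Omega>" for x
    unfolding w_def W_def Hw_def by (rule jet2_at_lin[OF ju[OF that] jv[OF that]])
  have Lw: "ndop (a x) (drift a x) (W x) (Hw x) = G (v x) - F (u x)" if "x \<in> \<Omega>" for x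
    unfolding W_def Hw_def ndop_lin Lu[OF that] Lv[OF that] by simp
  have cw: "continuous_on (closure \<Omega>) w"
    unfolding w_def by (intro continuous_intros ureg(3) vreg(3))
  have wbd: "w x = 0" if "x \<in> frontier \<Omega>" for x using ubd[OF that] vbd[OF that] by (simp add: w_def)
  have w0: "0 \<le> w x" if x: "x \<in> \<Omega>" for x
  proof (rule weak_minimum_principle[OF dom(1-3) c C ell jw cw _ _ x])
    show "0 \<le> w x" if "x \<in> frontier \<Omega>" for x using wbd[OF that] by simp
    fix x assume x: "x \<in> \<Omega>" "w x < 0"
    then have "G (v x) \<le> G (u x)" by (intro antimonoD[OF G(1)]) (simp add: w_def)
    then show "ndop (a x) (drift a x) (W x) (Hw x) \<le> 0" using Lw[OF x(1)] GF[OF x(1)] by simp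
  qed
  \<comment> \<open>The strong principle and the Hopf lemma need the source difference in the form \<open>Q * w\<close>.\<close>
  obtain Q where Q: "0 \<le> Q" and LwQ: "\<And>x. x \<in> \<Omega> \<Longrightarrow> ndop (a x) (drift a x) (W x) (Hw x) \<le> Q * w x"
  proof -
    have "compact (closure \<Omega>)" using dom(3) by simp
    then have "bounded (u ` closure \<Omega> \<union> v ` closure \<Omega>)"
      using ureg(3) vreg(3) compact_continuous_image compact_imp_bounded by (intro bounded_Un[THEN iffD2]) blast
    then obtain B where B: "\<And>x. x \<in> closure \<Omega> \<Longrightarrow> \<bar>u x\<bar> \<le> B" "\<And>x. x \<in> closure \<Omega> \<Longrightarrow> \<bar>v x\<bar> \<le> B"
      by (auto simp: bounded_iff)
    obtain Q where Q: "0 \<le> Q" "\<And>s t. s \<in> {-B..B} \<Longrightarrow> t \<in> {-B..B} \<Longrightarrow> \<bar>G s - G t\<bar> \<le> Q * \<bar>s - t\<bar>"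
      using Ck_on_2_locally_Lipschitz[OF G(3), of B] by blast
    show thesis
    proof (rule that[OF Q(1)])
      fix x assume x: "x \<in> \<Omega>"
      then have xc: "x \<in> closure \<Omega>" using closure_subset by blast
      have "v x \<in> {-B..B}" "u x \<in> {-B..B}" using B[OF xc] by auto
      from Q(2)[OF this] have "G (v x) - G (u x) \<le> Q * \<bar>v x - u x\<bar>" by linarith
      also have "\<bar>v x - u x\<bar> = w x" using w0[OF x] by (simp add: w_def)
      finally show "ndop (a x) (drift a x) (W x) (Hw x) \<le> Q * w x" using Lw[OF x] GF[OF x] by simp
    qed
  qed
  have "(\<forall>x\<in>\<Omega>. w x = 0) \<or> (\<forall>x\<in>\<Omega>. 0 < w x)"
  proof (rule strong_minimum_principle[OF dom(1,2) c C Q ell jw w0])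
    fix y assume "y \<in> \<Omega>"
    from eventually_nhds_in_open[OF dom(1) this]
    show "\<forall>\<^sub>F x in nhds y. ndop (a x) (drift a x) (W x) (Hw x) \<le> Q * w x"
      by eventually_elim (rule LwQ)
  qed
  \<comment> \<open>If the solutions coincided, the strict order of the sources on \<open>{0<..e}\<close> would force \<open>u = 0\<close>.\<close>
  moreover have "\<not> (\<forall>x\<in>\<Omega>. w x = 0)"
  proof
    assume z: "\<forall>x\<in>\<Omega>. w x = 0"
    have "u x = 0" if x: "x \<in> \<Omega>" for x
    proof -
      have "\<forall>\<^sub>F y in nhds x. w x \<le> w y"
        using eventually_nhds_in_open[OF dom(1) x] by eventually_elim (use z x in auto)
      then have "0 \<le> ndop (a x) (drift a x) (W x) (Hw x)"
      proof (rule ndop_local_min_nonneg[OF jw[OF x]])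
        have xc: "x \<in> closure \<Omega>" using x closure_subset by blast
        show "a x $ i $ j = a x $ j $ i" for i j by (rule asym[OF xc])
        show "0 \<le> d \<bullet> (a x *v d)" for d using aell[OF xc, of d] c by (smt (verit) mult_nonneg_nonneg zero_le_power2)
      qed
      then have "F (u x) \<le> G (u x)" using Lw[OF x] z x by (simp add: w_def)
      then show ?thesis using FG[of "u x"] u0[OF x] ue[OF x] by force
    qed
    then have "u y0 = 0" using continuous_constant_on_closure[OF ureg(3)] hpos(1) frc by blast
    then show False using ubd[OF hpos(1)] hpos(2) by simp
  qed
  ultimately have wpos: "0 < w x" if "x \<in> \<Omega>" for x using that by blast
  have x0c: "x0 \<in> closure \<Omega>" and x0n: "x0 \<notin> \<Omega>"
    using x0 dom(1) by (auto simp: frontier_def interior_open)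
  obtain U \<psi> \<phi> b where ch: "boundary_chart 2 \<alpha> \<Omega> x0 U \<psi> \<phi> b"
    using dom(4) x0 unfolding Ck_holder_boundary_def by blast
  define \<nu> where "\<nu> = outward_unit_normal \<Omega> x0"
  \<comment> \<open>The conormal derivative is the derivative in direction \<open>\<eta>\<close>, which points outward by ellipticity.\<close>
  define \<eta> where "\<eta> = transpose (a x0) *v \<nu>"
  have "transpose (a x0) = a x0" using asym[OF x0c] by (simp add: transpose_def vec_eq_iff)
  then have "c * (norm \<nu>)\<^sup>2 \<le> \<nu> \<bullet> \<eta>" using aell[OF x0c, of \<nu>] by (simp add: \<eta>_def)
  then have dir: "outward_unit_normal \<Omega> x0 \<bullet> (- \<eta>) < 0"
    using chart_normal_derivative(1)[OF ch x0] c by (simp add: \<nu>_def)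
  obtain M where M: "\<And>x. x \<in> \<Omega> \<Longrightarrow> norm (a x) \<le> M"
  proof -
    have "continuous_on (closure \<Omega>) a" using areg by (simp add: Ck_closure_def)
    then have "bounded (a ` closure \<Omega>)" using dom(3) by (intro compact_imp_bounded compact_continuous_image) auto
    then obtain M where "\<And>x. x \<in> closure \<Omega> \<Longrightarrow> norm (a x) \<le> M" by (auto simp: bounded_iff)
    then show thesis using that closure_subset[of \<Omega>] by blast
  qed
  obtain \<kappa> where \<kappa>: "0 < \<kappa>" "\<forall>\<^sub>F t in at_right 0. \<kappa> * t \<le> w (x0 + t *\<^sub>R (- \<eta>))"
    using hopf_at_chart[OF ch x0 c C Q ell M cw wbd wpos jw LwQ dir] by blast
  define p where "p u = (\<chi> j. Lim (at x0 within \<Omega>) (pd (axis j 1) u))" for u :: "real^'n \<Rightarrow> real"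
  have lim: "(W \<longlongrightarrow> 1 *\<^sub>R p u + - 1 *\<^sub>R p v) (at x0 within \<Omega>)"
    unfolding W_def p_def
    by (intro tendsto_intros Ck_closure_grad_limit ureg(1) vreg(1) x0c x0n)
  have "\<kappa> \<le> (1 *\<^sub>R p u + - 1 *\<^sub>R p v) \<bullet> (- \<eta>)"
    by (rule boundary_gradient_lower_bound[OF inward_line[OF ch x0 dir] x0c cw wbd[OF x0] _ lim x0n \<kappa>(2)])
      (rule jet2_at_has_derivative[OF jw])
  then show ?thesis
    using \<kappa>(1) unfolding conormal_derivative_eq_inner p_def[symmetric] \<nu>_def[symmetric] \<eta>_def[symmetric]
    by (simp add: inner_diff_left)
qed

theorem corollary2p1:
  fixes \<Omega> :: "(real^'n) set"
    and \<alpha> c R \<delta>\<^sub>0 :: real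
    and a :: "real^'n \<Rightarrow> real^'n^'n"
    and g :: "real^'n \<Rightarrow> real"
    and F\<^sub>1 F\<^sub>2 :: "real \<Rightarrow> real"
    and u\<^sub>1 u\<^sub>2 :: "real \<Rightarrow> real^'n \<Rightarrow> real"
    and x\<^sub>0 :: "real^'n"
  assumes "CARD('n) \<ge> 2"
    and "0 < \<alpha>" and "\<alpha> < 1"
    and "open \<Omega>" and "connected \<Omega>" and "bounded \<Omega>" and "\<Omega> \<noteq> {}"
    and "Ck_holder_boundary 2 \<alpha> \<Omega>"
    and "Ck_closure 2 \<Omega> a"
    and "\<forall>x\<in>closure \<Omega>. \<forall>i j. a x $ i $ j = a x $ j $ i"
    and "c > 0"
    and "\<forall>x\<in>closure \<Omega>. \<forall>\<xi>. (\<Sum>i\<in>UNIV. \<Sum>j\<in>UNIV. a x $ i $ j * \<xi> $ i * \<xi> $ j) \<ge> c * (norm \<xi>)\<^sup>2"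
    and "Ck_holder_frontier 2 \<alpha> \<Omega> g"
    and "R > 0" and "g ` frontier \<Omega> = {0..R}"
    and "Ck_on 2 UNIV F\<^sub>1" and "antimono F\<^sub>1" and "F\<^sub>1 0 = 0" and "real_analytic_on UNIV F\<^sub>1"
    and "Ck_on 2 UNIV F\<^sub>2" and "antimono F\<^sub>2" and "F\<^sub>2 0 = 0" and "real_analytic_on UNIV F\<^sub>2"
    and "\<forall>\<delta>\<in>{0..1}. dirichlet_solution \<alpha> \<Omega> a F\<^sub>1 (\<lambda>x. \<delta> * g x) (u\<^sub>1 \<delta>)"
    and "\<forall>\<delta>\<in>{0..1}. dirichlet_solution \<alpha> \<Omega> a F\<^sub>2 (\<lambda>x. \<delta> * g x) (u\<^sub>2 \<delta>)"
    and "x\<^sub>0 \<in> frontier \<Omega>"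
    and "0 < \<delta>\<^sub>0" and "\<delta>\<^sub>0 \<le> 1"
    and "\<forall>\<delta>\<in>{0..\<delta>\<^sub>0}. conormal_derivative \<Omega> a (u\<^sub>1 \<delta>) x\<^sub>0 = conormal_derivative \<Omega> a (u\<^sub>2 \<delta>) x\<^sub>0"
  shows "F\<^sub>1 = F\<^sub>2"
proof (rule ccontr)
  assume "F\<^sub>1 \<noteq> F\<^sub>2"
  then obtain y where y: "F\<^sub>1 y - F\<^sub>2 y \<noteq> 0" by (auto simp: fun_eq_iff)
  have an: "real_analytic_on UNIV (\<lambda>x. F\<^sub>1 x - F\<^sub>2 x)" using assms by (intro real_analytic_on_diff)
  have cont: "continuous_on UNIV (\<lambda>x. F\<^sub>1 x - F\<^sub>2 x)"
    using assms by (intro continuous_on_diff Ck_on_2_continuous)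
  have "F\<^sub>1 0 - F\<^sub>2 0 = 0" using assms by simp
  from real_analytic_right_sign[OF an cont this y]
  obtain e where e: "0 < e" and
    sgn: "(\<forall>t\<in>{0<..e}. F\<^sub>2 t < F\<^sub>1 t) \<or> (\<forall>t\<in>{0<..e}. F\<^sub>1 t < F\<^sub>2 t)"
    by auto
  define \<delta> where "\<delta> = min \<delta>\<^sub>0 (e / R)"
  have \<delta>: "0 < \<delta>" "\<delta> \<le> \<delta>\<^sub>0" "\<delta> \<le> 1" "\<delta> * R \<le> e"
  proof -
    show "0 < \<delta>" using assms(14,27) e by (simp add: \<delta>_def)
    show "\<delta> \<le> \<delta>\<^sub>0" by (simp add: \<delta>_def)
    then show "\<delta> \<le> 1" using assms(28) by simp
    have "\<delta> * R \<le> e / R * R" using assms(14) by (intro mult_right_mono) (simp_all add: \<delta>_def)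
    then show "\<delta> * R \<le> e" using assms(14) by simp
  qed
  have g01: "0 \<le> \<delta> * g x \<and> \<delta> * g x \<le> e" if "x \<in> frontier \<Omega>" for x
  proof -
    have "g x \<in> {0..R}" using that assms(15) by blast
    then have "\<delta> * g x \<le> \<delta> * R" using \<delta>(1) by (intro mult_left_mono) auto
    moreover have "0 \<le> \<delta> * g x" using \<open>g x \<in> {0..R}\<close> \<delta>(1) by simp
    ultimately show ?thesis using \<delta>(4) by linarith
  qed
  have "R \<in> g ` frontier \<Omega>" using assms(14,15) by simp
  then obtain y0 where y0: "y0 \<in> frontier \<Omega>" "0 < \<delta> * g y0" using assms(14) \<delta>(1) by auto
  have u: "dirichlet_solution \<alpha> \<Omega> a F\<^sub>1 (\<lambda>x. \<delta> * g x) (u\<^sub>1 \<delta>)"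
    and v: "dirichlet_solution \<alpha> \<Omega> a F\<^sub>2 (\<lambda>x. \<delta> * g x) (u\<^sub>2 \<delta>)" using assms(24,25) \<delta> by auto
  have asym: "\<And>x i j. x \<in> closure \<Omega> \<Longrightarrow> a x $ i $ j = a x $ j $ i" using assms(10) by blast
  have aell: "\<And>x v. x \<in> closure \<Omega> \<Longrightarrow> c * (norm v)\<^sup>2 \<le> v \<bullet> (a x *v v)"
    using assms(12) by (simp add: quadratic_form_eq)
  have eq: "conormal_derivative \<Omega> a (u\<^sub>1 \<delta>) x\<^sub>0 = conormal_derivative \<Omega> a (u\<^sub>2 \<delta>) x\<^sub>0"
    using assms(29) \<delta> by auto
  note comparison = conormal_derivative_strict_comparison[OF assms(4-6,8,9) _ assms(11)]
  from sgn show False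
  proof
    assume "\<forall>t\<in>{0<..e}. F\<^sub>2 t < F\<^sub>1 t"
    then have "conormal_derivative \<Omega> a (u\<^sub>1 \<delta>) x\<^sub>0 < conormal_derivative \<Omega> a (u\<^sub>2 \<delta>) x\<^sub>0"
      by (intro comparison[OF asym aell assms(17,18,21,22,20) u v _ g01 y0 assms(26)]) auto
    then show False using eq by simp
  next
    assume "\<forall>t\<in>{0<..e}. F\<^sub>1 t < F\<^sub>2 t"
    then have "conormal_derivative \<Omega> a (u\<^sub>2 \<delta>) x\<^sub>0 < conormal_derivative \<Omega> a (u\<^sub>1 \<delta>) x\<^sub>0"
      by (intro comparison[OF asym aell assms(21,22,17,18,16) v u _ g01 y0 assms(26)]) auto
    then show False using eq by simp
  qed
qed

end
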